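(* Consider pairs $(\psi,\varphi)$ of the form $\psi(z)=\frac{b}{1-a_0z}$, $\varphi(z)=a_0+\frac{a_1z}{1-a_0z}$, where $a_0\in\mathbb{D}$, $a_1,b\in\mathbb{C}$, and $\varphi$ is an analytic self-map of $\mathbb{D}$; call such pairs admissible. Let $C_{\widetilde\psi,\widetilde\varphi}$ be a (bounded) weighted composition operator on $H^2$. (1) Let $p\in\mathbb{D}\setminus\{0\}$ and $|c|=1$, and put $\varphi_p(z)=\frac{\overline{p}}{p}\frac{p-z}{1-\overline{p}z}$ and $\psi_p(z)=c\frac{(1-|p|^2)^{1/2}}{1-\overline{p}z}$. Then $C_{\widetilde\psi,\widetilde\varphi}$ is complex symmetric with conjugation $C_{\psi_p,\varphi_p}J$ if and only if $\widetilde\psi=\psi_p\cdot(\psi\circ\varphi_p)$ and $\widetilde\varphi=\varphi\circ\varphi_p$ for some admissible pair $(\psi,\varphi)$. (2) Let $|\lambda|=1$. Then $C_{\widetilde\psi,\widetilde\varphi}$ is complex symmetric with conjugation $C_{\lambda z}J$ if and only if $\widetilde\psi(z)=\psi(\lambda z)$ and $\widetilde\varphi(z)=\varphi(\lambda z)$ for some admissible pair $(\psi,\varphi)$.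
   Context: $\mathbb{D}$ is the open unit disk and $H^2$ is the Hardy space on $\mathbb{D}$. For $\psi$ analytic on $\mathbb{D}$ and $\varphi$ an analytic self-map of $\mathbb{D}$, $(C_{\psi,\varphi}f)(z)=\psi(z)f(\varphi(z))$; $C_{\lambda z}$ is the composition operator $f\mapsto f(\lambda z)$. A conjugation is an isometric, antilinear involution $C$ on a complex Hilbert space; a bounded operator $T$ is complex symmetric with conjugation $C$ if $CT^*C=T$. $J$ is the conjugation on $H^2$ given by $(Jf)(z)=\overline{f(\overline{z})}$. The antilinear maps $C_{\psi_p,\varphi_p}J$ and $C_{\lambda z}J$ are conjugations on $H^2$.
   Formalization: The "only if" directions in (1) and (2) additionally assume that the weight ψ̃ is not identically zero; for ψ̃ = 0 the operator is 0 and complex symmetric for every self-map, e.g. φ̃(z) = z², so the literal claim fails. The "if" directions are unrestricted. *)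

theory Defs
  imports "HOL-Complex_Analysis.Complex_Analysis"
begin

abbreviation unit_disk :: "complex set" where
  "unit_disk \<equiv> ball 0 1"

text \<open>
  The Hardy space: analytic functions on the disk with square-summable Taylor coefficients.
  An element is represented by the total function that is 0 off the disk, so that HOL equality
  of two members of \<open>hardy_space\<close> is equality as functions on the disk.
\<close>

definition taylor_coeff :: "(complex \<Rightarrow> complex) \<Rightarrow> nat \<Rightarrow> complex" where
  "taylor_coeff f n = (deriv ^^ n) f 0 / fact n"

definition hardy_space :: "(complex \<Rightarrow> complex) set" where
  "hardy_space = {f. f holomorphic_on unit_disk \<and> (\<forall>z. z \<notin> unit_disk \<longrightarrow> f z = 0) \<and>
      summable (\<lambda>n. (cmod (taylor_coeff f n))\<^sup>2)}"

definition hardy_inner :: "(complex \<Rightarrow> complex) \<Rightarrow> (complex \<Rightarrow> complex) \<Rightarrow> complex" where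
  "hardy_inner f g = (\<Sum>n. taylor_coeff f n * cnj (taylor_coeff g n))"

definition hardy_norm :: "(complex \<Rightarrow> complex) \<Rightarrow> real" where
  "hardy_norm f = sqrt (\<Sum>n. (cmod (taylor_coeff f n))\<^sup>2)"

definition hardy_bounded_operator :: "((complex \<Rightarrow> complex) \<Rightarrow> complex \<Rightarrow> complex) \<Rightarrow> bool" where
  "hardy_bounded_operator T \<longleftrightarrow>
     (\<forall>f\<in>hardy_space. T f \<in> hardy_space) \<and>
     (\<forall>f\<in>hardy_space. \<forall>g\<in>hardy_space. T (\<lambda>z. f z + g z) = (\<lambda>z. T f z + T g z)) \<and>
     (\<forall>a. \<forall>f\<in>hardy_space. T (\<lambda>z. a * f z) = (\<lambda>z. a * T f z)) \<and>
     (\<exists>K. \<forall>f\<in>hardy_space. hardy_norm (T f) \<le> K * hardy_norm f)"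

text \<open>
  For a bounded operator \<open>T\<close> and \<open>g\<close> in the Hardy space the vector \<open>h\<close> below exists
  (Riesz representation) and is unique.
\<close>

definition hardy_adjoint ::
    "((complex \<Rightarrow> complex) \<Rightarrow> complex \<Rightarrow> complex) \<Rightarrow> (complex \<Rightarrow> complex) \<Rightarrow> complex \<Rightarrow> complex" where
  "hardy_adjoint T g =
     (THE h. h \<in> hardy_space \<and> (\<forall>f\<in>hardy_space. hardy_inner (T f) g = hardy_inner f h))"

definition hardy_conjugation :: "((complex \<Rightarrow> complex) \<Rightarrow> complex \<Rightarrow> complex) \<Rightarrow> bool" where
  "hardy_conjugation C \<longleftrightarrow>
     (\<forall>f\<in>hardy_space. C f \<in> hardy_space) \<and>
     (\<forall>f\<in>hardy_space. \<forall>g\<in>hardy_space. C (\<lambda>z. f z + g z) = (\<lambda>z. C f z + C g z)) \<and>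
     (\<forall>a. \<forall>f\<in>hardy_space. C (\<lambda>z. a * f z) = (\<lambda>z. cnj a * C f z)) \<and>
     (\<forall>f\<in>hardy_space. hardy_norm (C f) = hardy_norm f) \<and>
     (\<forall>f\<in>hardy_space. C (C f) = f)"

definition complex_symmetric_with ::
    "((complex \<Rightarrow> complex) \<Rightarrow> complex \<Rightarrow> complex) \<Rightarrow>
     ((complex \<Rightarrow> complex) \<Rightarrow> complex \<Rightarrow> complex) \<Rightarrow> bool" where
  "complex_symmetric_with T C \<longleftrightarrow>
     hardy_bounded_operator T \<and> hardy_conjugation C \<and>
     (\<forall>f\<in>hardy_space. C (hardy_adjoint T (C f)) = T f)"

definition weighted_comp ::
    "(complex \<Rightarrow> complex) \<Rightarrow> (complex \<Rightarrow> complex) \<Rightarrow> (complex \<Rightarrow> complex) \<Rightarrow> complex \<Rightarrow> complex" where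
  "weighted_comp \<psi> \<phi> f = (\<lambda>z. if z \<in> unit_disk then \<psi> z * f (\<phi> z) else 0)"

definition comp_op :: "(complex \<Rightarrow> complex) \<Rightarrow> (complex \<Rightarrow> complex) \<Rightarrow> complex \<Rightarrow> complex" where
  "comp_op \<phi> = weighted_comp (\<lambda>_. 1) \<phi>"

definition J_conj :: "(complex \<Rightarrow> complex) \<Rightarrow> complex \<Rightarrow> complex" where
  "J_conj f = (\<lambda>z. cnj (f (cnj z)))"

definition analytic_self_map :: "(complex \<Rightarrow> complex) \<Rightarrow> bool" where
  "analytic_self_map \<phi> \<longleftrightarrow> \<phi> holomorphic_on unit_disk \<and> \<phi> ` unit_disk \<subseteq> unit_disk"

definition admissible_pair :: "(complex \<Rightarrow> complex) \<Rightarrow> (complex \<Rightarrow> complex) \<Rightarrow> bool" where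
  "admissible_pair \<psi> \<phi> \<longleftrightarrow>
     (\<exists>a0 a1 b. a0 \<in> unit_disk \<and>
        (\<forall>z\<in>unit_disk. \<psi> z = b / (1 - a0 * z)) \<and>
        (\<forall>z\<in>unit_disk. \<phi> z = a0 + a1 * z / (1 - a0 * z))) \<and>
     analytic_self_map \<phi>"

definition phi_p :: "complex \<Rightarrow> complex \<Rightarrow> complex" where
  "phi_p p z = (cnj p / p) * ((p - z) / (1 - cnj p * z))"

definition psi_p :: "complex \<Rightarrow> complex \<Rightarrow> complex \<Rightarrow> complex" where
  "psi_p c p z = c * (of_real (sqrt (1 - (cmod p)\<^sup>2)) / (1 - cnj p * z))"

end

theory Submission
  imports Defs
begin

text \<open>
  Write the conjugation as \<open>C = W J\<close> with \<open>W\<close> the weighted composition operator of symbols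
  \<open>(u, s)\<close>. Both conjugations share three pointwise properties: \<open>C C = id\<close>, \<open>s\<close> maps the disk to itself,
  and \<open>u(z) / (1 - x s(z))\<close> is symmetric in \<open>x\<close> and \<open>z\<close>. Evaluating \<open>C T\<^sup>* C = T\<close> at \<open>C K\<^sub>v\<close>, where
  \<open>K\<^sub>v\<close> is a reproducing kernel, turns complex symmetry of the operator with symbols
  \<open>(u \<cdot> (\<psi> \<circ> s), \<phi> \<circ> s)\<close> into the same symmetry for \<open>(\<psi>, \<phi>)\<close>, and the pairs with \<open>\<psi> \<noteq> 0\<close>
  solving this functional equation are exactly the admissible ones. That \<open>C\<close> is isometric follows
  on polynomials from multiplication by a Blaschke factor being isometric.
\<close>

section \<open>Hardy space\<close>

text \<open>The convergent series is the formal expansion of \<open>f\<close> at 0, and power series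
  coefficients are unique. Coefficients below are mostly read off this way from an explicit
  expansion.\<close>

lemma taylor_coeff_eqI:
  assumes "\<And>z. z \<in> unit_disk \<Longrightarrow> (\<lambda>n. a n * z ^ n) sums f z"
  shows "taylor_coeff f n = a n"
proof -
  have "eventually (\<lambda>z. z \<in> unit_disk) (nhds (0::complex))"
    by (intro eventually_nhds_in_open) auto
  then have "f has_fps_expansion Abs_fps a"
    by (intro has_fps_expansionI) (auto elim!: eventually_mono intro: assms)
  from fps_nth_fps_expansion[OF this, of n] show ?thesis
    by (simp add: taylor_coeff_def)
qed

lemma taylor_coeff_sums:
  assumes "f holomorphic_on unit_disk" "z \<in> unit_disk"
  shows "(\<lambda>n. taylor_coeff f n * z ^ n) sums f z"
  using holomorphic_power_series[OF assms] by (simp add: taylor_coeff_def)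

lemma taylor_coeff_cong:
  assumes "f holomorphic_on unit_disk" "\<And>z. z \<in> unit_disk \<Longrightarrow> g z = f z"
  shows "taylor_coeff g n = taylor_coeff f n"
  by (rule taylor_coeff_eqI) (use taylor_coeff_sums[OF assms(1)] assms(2) in simp)

lemma hardy_spaceI:
  assumes "\<And>z. z \<in> unit_disk \<Longrightarrow> (\<lambda>n. a n * z ^ n) sums f z"
    and "\<And>z. z \<notin> unit_disk \<Longrightarrow> f z = 0"
    and "summable (\<lambda>n. (cmod (a n))\<^sup>2)"
  shows "f \<in> hardy_space"
proof -
  have "f holomorphic_on unit_disk"
    by (rule power_series_holomorphic[where a = a]) (use assms(1) in simp)
  then show ?thesis
    using assms taylor_coeff_eqI[of a f] by (simp add: hardy_space_def)
qed

lemma hardy_space_sums: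
  assumes "f \<in> hardy_space" "z \<in> unit_disk"
  shows "(\<lambda>n. taylor_coeff f n * z ^ n) sums f z"
  using assms taylor_coeff_sums by (auto simp: hardy_space_def)

lemma hardy_space_holomorphic: "f \<in> hardy_space \<Longrightarrow> f holomorphic_on unit_disk"
  and hardy_space_outside: "f \<in> hardy_space \<Longrightarrow> z \<notin> unit_disk \<Longrightarrow> f z = 0"
  and hardy_space_summable: "f \<in> hardy_space \<Longrightarrow> summable (\<lambda>n. (cmod (taylor_coeff f n))\<^sup>2)"
  by (auto simp: hardy_space_def)

lemma hardy_space_eqI:
  assumes "f \<in> hardy_space" "g \<in> hardy_space" "\<And>z. z \<in> unit_disk \<Longrightarrow> f z = g z"
  shows "f = g"
proof
  fix z show "f z = g z"
    using assms hardy_space_outside by (cases "z \<in> unit_disk") metis+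
qed

lemma taylor_coeff_linear:
  assumes "f holomorphic_on unit_disk" "g holomorphic_on unit_disk"
  shows "taylor_coeff (\<lambda>z. a * f z + b * g z) n = a * taylor_coeff f n + b * taylor_coeff g n"
proof (rule taylor_coeff_eqI)
  fix z :: complex assume "z \<in> unit_disk"
  then have "(\<lambda>n. a * (taylor_coeff f n * z ^ n) + b * (taylor_coeff g n * z ^ n)) sums (a * f z + b * g z)"
    by (intro sums_add sums_mult taylor_coeff_sums assms)
  then show "(\<lambda>n. (a * taylor_coeff f n + b * taylor_coeff g n) * z ^ n) sums (a * f z + b * g z)"
    by (simp add: algebra_simps)
qed

lemma summable_power2_linear:
  fixes x y :: "nat \<Rightarrow> complex"
  assumes "summable (\<lambda>n. (cmod (x n))\<^sup>2)" "summable (\<lambda>n. (cmod (y n))\<^sup>2)"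
  shows "summable (\<lambda>n. (cmod (a * x n + b * y n))\<^sup>2)"
proof (rule summable_comparison_test)
  have "(cmod (a * x n + b * y n))\<^sup>2 \<le> 2 * (cmod a)\<^sup>2 * (cmod (x n))\<^sup>2 + 2 * (cmod b)\<^sup>2 * (cmod (y n))\<^sup>2" for n
  proof -
    have "(cmod (a * x n + b * y n))\<^sup>2 \<le> (cmod (a * x n) + cmod (b * y n))\<^sup>2"
      by (intro power_mono norm_triangle_ineq) auto
    also have "\<dots> \<le> 2 * (cmod (a * x n))\<^sup>2 + 2 * (cmod (b * y n))\<^sup>2"
      using sum_squares_bound[of "cmod (a * x n)" "cmod (b * y n)"] by (simp add: power2_sum)
    finally show ?thesis by (simp add: norm_mult power_mult_distrib)
  qed
  then show "\<exists>N. \<forall>n\<ge>N. norm ((cmod (a * x n + b * y n))\<^sup>2)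
      \<le> 2 * (cmod a)\<^sup>2 * (cmod (x n))\<^sup>2 + 2 * (cmod b)\<^sup>2 * (cmod (y n))\<^sup>2" by simp
  show "summable (\<lambda>n. 2 * (cmod a)\<^sup>2 * (cmod (x n))\<^sup>2 + 2 * (cmod b)\<^sup>2 * (cmod (y n))\<^sup>2)"
    by (intro summable_add summable_mult assms)
qed

lemma hardy_space_linear:
  assumes "f \<in> hardy_space" "g \<in> hardy_space"
  shows "(\<lambda>z. a * f z + b * g z) \<in> hardy_space"
proof -
  note holo = assms[THEN hardy_space_holomorphic]
  have "summable (\<lambda>n. (cmod (taylor_coeff (\<lambda>z. a * f z + b * g z) n))\<^sup>2)"
    unfolding taylor_coeff_linear[OF holo]
    by (intro summable_power2_linear hardy_space_summable assms)
  then show ?thesis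
    using holo assms[THEN hardy_space_outside]
    by (auto simp: hardy_space_def intro!: holomorphic_intros)
qed

lemma hardy_space_scale: "f \<in> hardy_space \<Longrightarrow> (\<lambda>z. a * f z) \<in> hardy_space"
  using hardy_space_linear[of f f a 0] by simp

section \<open>The inner product\<close>

text \<open>The finite inequality bounds all partial sums of the moduli by one constant, which gives
  absolute convergence and the estimate together.\<close>

lemma Cauchy_Schwarz_suminf:
  fixes x y :: "nat \<Rightarrow> complex"
  assumes "summable (\<lambda>n. (cmod (x n))\<^sup>2)" "summable (\<lambda>n. (cmod (y n))\<^sup>2)"
  shows "summable (\<lambda>n. x n * cnj (y n))"
    and "cmod (\<Sum>n. x n * cnj (y n)) \<le> sqrt (\<Sum>n. (cmod (x n))\<^sup>2) * sqrt (\<Sum>n. (cmod (y n))\<^sup>2)"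
proof -
  have le: "(\<Sum>n<N. cmod (x n * cnj (y n))) \<le> sqrt (\<Sum>n. (cmod (x n))\<^sup>2) * sqrt (\<Sum>n. (cmod (y n))\<^sup>2)" for N
  proof -
    have "(\<Sum>n<N. cmod (x n * cnj (y n))) \<le> L2_set (\<lambda>n. cmod (x n)) {..<N} * L2_set (\<lambda>n. cmod (y n)) {..<N}"
      using L2_set_mult_ineq[of "\<lambda>n. cmod (x n)" "\<lambda>n. cmod (y n)" "{..<N}"] by (simp add: norm_mult)
    also have "\<dots> \<le> sqrt (\<Sum>n. (cmod (x n))\<^sup>2) * sqrt (\<Sum>n. (cmod (y n))\<^sup>2)"
      unfolding L2_set_def
      by (intro mult_mono real_sqrt_le_mono sum_le_suminf assms real_sqrt_ge_zero suminf_nonneg sum_nonneg) auto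
    finally show ?thesis .
  qed
  have norm_summable: "summable (\<lambda>n. cmod (x n * cnj (y n)))"
    by (rule summableI_nonneg_bounded[OF _ le]) simp
  then show "summable (\<lambda>n. x n * cnj (y n))" by (rule summable_norm_cancel)
  have "cmod (\<Sum>n. x n * cnj (y n)) \<le> (\<Sum>n. cmod (x n * cnj (y n)))"
    by (rule summable_norm[OF norm_summable])
  also have "\<dots> \<le> sqrt (\<Sum>n. (cmod (x n))\<^sup>2) * sqrt (\<Sum>n. (cmod (y n))\<^sup>2)"
    by (rule suminf_le_const[OF norm_summable le])
  finally show "cmod (\<Sum>n. x n * cnj (y n)) \<le> sqrt (\<Sum>n. (cmod (x n))\<^sup>2) * sqrt (\<Sum>n. (cmod (y n))\<^sup>2)" .
qed

lemma hardy_inner_sums: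
  assumes "f \<in> hardy_space" "g \<in> hardy_space"
  shows "(\<lambda>n. taylor_coeff f n * cnj (taylor_coeff g n)) sums hardy_inner f g"
  unfolding hardy_inner_def
  by (intro summable_sums Cauchy_Schwarz_suminf(1) assms hardy_space_summable)

lemma hardy_inner_bound:
  assumes "f \<in> hardy_space" "g \<in> hardy_space"
  shows "cmod (hardy_inner f g) \<le> hardy_norm f * hardy_norm g"
  unfolding hardy_inner_def hardy_norm_def
  by (intro Cauchy_Schwarz_suminf(2) assms hardy_space_summable)

lemma hardy_inner_linear:
  assumes "f \<in> hardy_space" "g \<in> hardy_space" "h \<in> hardy_space"
  shows "hardy_inner (\<lambda>z. a * f z + b * g z) h = a * hardy_inner f h + b * hardy_inner g h"
proof -
  have "(\<lambda>n. a * (taylor_coeff f n * cnj (taylor_coeff h n)) + b * (taylor_coeff g n * cnj (taylor_coeff h n)))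
      sums (a * hardy_inner f h + b * hardy_inner g h)"
    by (intro sums_add sums_mult hardy_inner_sums assms)
  moreover have "taylor_coeff (\<lambda>z. a * f z + b * g z) n = a * taylor_coeff f n + b * taylor_coeff g n" for n
    using assms by (intro taylor_coeff_linear hardy_space_holomorphic)
  ultimately have "(\<lambda>n. taylor_coeff (\<lambda>z. a * f z + b * g z) n * cnj (taylor_coeff h n))
      sums (a * hardy_inner f h + b * hardy_inner g h)"
    by (simp add: algebra_simps)
  then show ?thesis
    by (simp add: hardy_inner_def sums_iff)
qed

lemma hardy_inner_scale:
  assumes "f \<in> hardy_space" "h \<in> hardy_space"
  shows "hardy_inner (\<lambda>z. a * f z) h = a * hardy_inner f h"
  using hardy_inner_linear[OF assms(1) assms(1,2), of a 0] by simp

lemma hardy_inner_commute: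
  assumes "f \<in> hardy_space" "g \<in> hardy_space"
  shows "hardy_inner g f = cnj (hardy_inner f g)"
proof -
  have "(\<lambda>n. cnj (taylor_coeff f n * cnj (taylor_coeff g n))) sums cnj (hardy_inner f g)"
    using hardy_inner_sums[OF assms] by (simp only: sums_cnj)
  then show ?thesis
    by (simp add: hardy_inner_def sums_iff mult.commute)
qed

section \<open>Reproducing kernels and monomials\<close>

text \<open>The Szego kernel at \<open>w\<close>, cut off outside the disk as membership in
  \<open>hardy_space\<close> requires.\<close>

definition hardy_kernel :: "complex \<Rightarrow> complex \<Rightarrow> complex" where
  "hardy_kernel w = (\<lambda>z. if z \<in> unit_disk then 1 / (1 - cnj w * z) else 0)"

definition hardy_monomial :: "nat \<Rightarrow> complex \<Rightarrow> complex" where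
  "hardy_monomial n = (\<lambda>z. if z \<in> unit_disk then z ^ n else 0)"

lemma unit_disk_mult_less:
  fixes x y :: complex
  assumes "x \<in> unit_disk" "y \<in> unit_disk"
  shows "cmod (x * y) < 1"
  using assms mult_strict_mono'[of "cmod x" 1 "cmod y" 1] by (simp add: norm_mult)

lemma unit_disk_mult_neq:
  fixes x y :: complex
  assumes "x \<in> unit_disk" "y \<in> unit_disk"
  shows "1 - x * y \<noteq> 0"
  using unit_disk_mult_less[OF assms] by auto

lemma hardy_kernel_sums:
  assumes "w \<in> unit_disk" "z \<in> unit_disk"
  shows "(\<lambda>n. cnj w ^ n * z ^ n) sums hardy_kernel w z"
  using geometric_sums[of "cnj w * z"] unit_disk_mult_less[of "cnj w" z] assms
  by (simp add: hardy_kernel_def power_mult_distrib)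

lemma
  assumes "w \<in> unit_disk"
  shows taylor_coeff_kernel: "taylor_coeff (hardy_kernel w) n = cnj w ^ n"
    and hardy_kernel_in: "hardy_kernel w \<in> hardy_space"
proof -
  show "taylor_coeff (hardy_kernel w) n = cnj w ^ n"
    by (intro taylor_coeff_eqI hardy_kernel_sums assms)
  have "summable (\<lambda>n. ((cmod w)\<^sup>2) ^ n)"
    using assms by (intro summable_geometric) (simp add: power_less_one_iff)
  then have "summable (\<lambda>n. (cmod (cnj w ^ n))\<^sup>2)"
    by (simp add: norm_power power_mult[symmetric] mult.commute)
  then show "hardy_kernel w \<in> hardy_space"
    by (intro hardy_spaceI[OF hardy_kernel_sums[OF assms]]) (auto simp: hardy_kernel_def)
qed

text \<open>The reproducing property: the conjugated coefficients of the kernel are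
  \<open>w ^ n\<close>, so the inner product is the Taylor series of \<open>f\<close> at
  \<open>w\<close>.\<close>

lemma hardy_inner_kernel:
  assumes "f \<in> hardy_space" "w \<in> unit_disk"
  shows "hardy_inner f (hardy_kernel w) = f w"
  using hardy_space_sums[OF assms] by (simp add: hardy_inner_def taylor_coeff_kernel[OF assms(2)] sums_iff)

lemma hardy_kernel_inner:
  assumes "f \<in> hardy_space" "w \<in> unit_disk"
  shows "hardy_inner (hardy_kernel w) f = cnj (f w)"
  using hardy_inner_commute[of f "hardy_kernel w"] hardy_inner_kernel[of f w] assms
  by (simp add: hardy_kernel_in)

lemma hardy_monomial_sums:
  assumes "z \<in> unit_disk"
  shows "(\<lambda>k. (if k = n then 1 else 0) * z ^ k) sums hardy_monomial n z"
proof -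
  have "(\<lambda>k. (if k = n then 1 else 0) * z ^ k) = (\<lambda>k. if k = n then z ^ k else 0)" by auto
  then show ?thesis using sums_single[of n "\<lambda>k. z ^ k"] assms by (simp add: hardy_monomial_def)
qed

lemma taylor_coeff_monomial: "taylor_coeff (hardy_monomial n) k = (if k = n then 1 else 0)"
  by (intro taylor_coeff_eqI hardy_monomial_sums)

lemma hardy_monomial_in: "hardy_monomial n \<in> hardy_space"
proof (rule hardy_spaceI[OF hardy_monomial_sums])
  have "(\<lambda>k. (cmod (if k = n then 1 else 0))\<^sup>2) = (\<lambda>k. if k = n then 1 else 0)" by auto
  then show "summable (\<lambda>k. (cmod (if k = n then 1 else 0))\<^sup>2)" by simp
qed (auto simp: hardy_monomial_def)

section \<open>Approximation by polynomials and computation of adjoints\<close>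

definition hardy_partial :: "(nat \<Rightarrow> complex) \<Rightarrow> nat \<Rightarrow> complex \<Rightarrow> complex" where
  "hardy_partial a N = (\<lambda>z. \<Sum>n<N. a n * hardy_monomial n z)"

text \<open>The factor \<open>1 *\<close> gives the sum the shape \<open>a * f z + b * g z\<close>
  that the linearity lemmas expect.\<close>

lemma hardy_partial_Suc:
  "hardy_partial a (Suc N) = (\<lambda>z. 1 * hardy_partial a N z + a N * hardy_monomial N z)"
  by (simp add: hardy_partial_def)

lemma hardy_partial_in: "hardy_partial a N \<in> hardy_space"
proof (induction N)
  case 0
  show ?case using hardy_space_scale[OF hardy_monomial_in, of 0] by (simp add: hardy_partial_def)
next
  case (Suc N)
  then show ?case
    unfolding hardy_partial_Suc by (intro hardy_space_linear hardy_monomial_in)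
qed

lemma taylor_coeff_partial: "taylor_coeff (hardy_partial a N) k = (if k < N then a k else 0)"
proof (induction N)
  case 0
  show ?case by (rule taylor_coeff_eqI) (simp add: hardy_partial_def)
next
  case (Suc N)
  have "taylor_coeff (hardy_partial a (Suc N)) k
      = 1 * taylor_coeff (hardy_partial a N) k + a N * taylor_coeff (hardy_monomial N) k"
    unfolding hardy_partial_Suc
    by (intro taylor_coeff_linear hardy_space_holomorphic hardy_partial_in hardy_monomial_in)
  then show ?case by (auto simp: Suc.IH taylor_coeff_monomial less_Suc_eq)
qed

text \<open>The squared norm of the remainder is a tail of the convergent series of squared
  coefficients.\<close>

lemma hardy_norm_partial_tendsto:
  assumes f: "f \<in> hardy_space"
  defines "P \<equiv> hardy_partial (taylor_coeff f)"
  shows "(\<lambda>N. hardy_norm (\<lambda>z. 1 * f z + (- 1) * P N z)) \<longlonglongrightarrow> 0"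
proof -
  have eq: "hardy_norm (\<lambda>z. 1 * f z + (- 1) * P N z) = sqrt (\<Sum>n. (cmod (taylor_coeff f (n + N)))\<^sup>2)" for N
  proof -
    have c: "taylor_coeff (\<lambda>z. 1 * f z + (- 1) * P N z) n = (if n < N then 0 else taylor_coeff f n)" for n
      using taylor_coeff_linear[of f "P N" 1 "-1" n] hardy_space_holomorphic[OF f]
        hardy_space_holomorphic[OF hardy_partial_in]
      by (simp add: P_def taylor_coeff_partial)
    have "summable (\<lambda>n. (cmod (taylor_coeff (\<lambda>z. 1 * f z + (- 1) * P N z) n))\<^sup>2)"
      unfolding P_def by (intro hardy_space_summable hardy_space_linear f hardy_partial_in)
    from suminf_split_initial_segment[OF this, of N]
    have "(\<Sum>n. (cmod (taylor_coeff (\<lambda>z. 1 * f z + (- 1) * P N z) n))\<^sup>2) = (\<Sum>n. (cmod (taylor_coeff f (n + N)))\<^sup>2)"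
      unfolding c by simp
    then show ?thesis by (simp add: hardy_norm_def)
  qed
  have "(\<lambda>N. sqrt (\<Sum>n. (cmod (taylor_coeff f (n + N)))\<^sup>2)) \<longlonglongrightarrow> sqrt 0"
    by (intro tendsto_real_sqrt suminf_exist_split2 hardy_space_summable f)
  then show ?thesis unfolding eq by simp
qed

text \<open>The functional taking \<open>f\<close> to \<open>hardy_inner (T f) g\<close> is linear
  and continuous. Its values at the Taylor polynomials of \<open>f\<close> are the partial sums of
  this series, and those polynomials tend to \<open>f\<close> in norm.\<close>

lemma bounded_operator_inner_sums:
  assumes T: "hardy_bounded_operator T" and f: "f \<in> hardy_space" and g: "g \<in> hardy_space"
  shows "(\<lambda>n. taylor_coeff f n * hardy_inner (T (hardy_monomial n)) g) sums hardy_inner (T f) g"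
proof -
  have T_in: "\<And>f. f \<in> hardy_space \<Longrightarrow> T f \<in> hardy_space"
    and T_add: "\<And>f g. f \<in> hardy_space \<Longrightarrow> g \<in> hardy_space \<Longrightarrow> T (\<lambda>z. f z + g z) = (\<lambda>z. T f z + T g z)"
    and T_scale: "\<And>a f. f \<in> hardy_space \<Longrightarrow> T (\<lambda>z. a * f z) = (\<lambda>z. a * T f z)"
    using T by (auto simp: hardy_bounded_operator_def)
  obtain K where K: "\<And>f. f \<in> hardy_space \<Longrightarrow> hardy_norm (T f) \<le> K * hardy_norm f"
    using T unfolding hardy_bounded_operator_def by blast
  have T_linear: "T (\<lambda>z. a * f z + b * g z) = (\<lambda>z. a * T f z + b * T g z)"
    if "f \<in> hardy_space" "g \<in> hardy_space" for a b f g
    using T_add[OF hardy_space_scale[OF that(1)] hardy_space_scale[OF that(2)], of a b]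
      T_scale[OF that(1)] T_scale[OF that(2)] by simp
  define P where "P = hardy_partial (taylor_coeff f)"
  have P_in: "P N \<in> hardy_space" for N unfolding P_def by (rule hardy_partial_in)
  have inner_P: "hardy_inner (T (P N)) g = (\<Sum>n<N. taylor_coeff f n * hardy_inner (T (hardy_monomial n)) g)" for N
  proof (induction N)
    case 0
    \<comment> \<open>Homogeneity with factor 0 supplies the value of \<open>T\<close> at the zero
      function.\<close>
    have "P 0 = (\<lambda>z. 0 * f z)" by (simp add: P_def hardy_partial_def)
    then have "T (P 0) = (\<lambda>z. 0 * T f z)" using T_scale[OF f, of 0] by simp
    then show ?case using hardy_inner_scale[OF T_in[OF f] g, of 0] by simp
  next
    case (Suc N)
    have "T (P (Suc N)) = (\<lambda>z. 1 * T (P N) z + taylor_coeff f N * T (hardy_monomial N) z)"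
      unfolding P_def hardy_partial_Suc by (intro T_linear hardy_partial_in hardy_monomial_in)
    then have "hardy_inner (T (P (Suc N))) g
        = 1 * hardy_inner (T (P N)) g + taylor_coeff f N * hardy_inner (T (hardy_monomial N)) g"
      by (simp only:) (intro hardy_inner_linear T_in P_in hardy_monomial_in g)
    then show ?case by (simp add: Suc.IH)
  qed
  have "cmod (hardy_inner (T (P N)) g - hardy_inner (T f) g)
      \<le> K * hardy_norm (\<lambda>z. 1 * f z + (- 1) * P N z) * hardy_norm g" for N
  proof -
    have in_H: "(\<lambda>z. 1 * f z + (- 1) * P N z) \<in> hardy_space"
      by (intro hardy_space_linear f P_in)
    have "hardy_inner (T (\<lambda>z. 1 * f z + (- 1) * P N z)) g = 1 * hardy_inner (T f) g + (- 1) * hardy_inner (T (P N)) g"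
      unfolding T_linear[OF f P_in] by (intro hardy_inner_linear T_in f P_in g)
    then have "cmod (hardy_inner (T (P N)) g - hardy_inner (T f) g)
        = cmod (hardy_inner (T (\<lambda>z. 1 * f z + (- 1) * P N z)) g)"
      by (simp add: norm_minus_commute)
    also have "\<dots> \<le> hardy_norm (T (\<lambda>z. 1 * f z + (- 1) * P N z)) * hardy_norm g"
      by (intro hardy_inner_bound T_in in_H g)
    also have "\<dots> \<le> K * hardy_norm (\<lambda>z. 1 * f z + (- 1) * P N z) * hardy_norm g"
      using g by (intro mult_right_mono K in_H) (auto simp: hardy_norm_def intro!: suminf_nonneg hardy_space_summable)
    finally show ?thesis .
  qed
  then have bound: "\<forall>\<^sub>F N in sequentially. norm (hardy_inner (T (P N)) g - hardy_inner (T f) g)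
      \<le> K * hardy_norm (\<lambda>z. 1 * f z + (- 1) * P N z) * hardy_norm g"
    by (intro always_eventually allI)
  have "(\<lambda>N. K * hardy_norm (\<lambda>z. 1 * f z + (- 1) * P N z) * hardy_norm g) \<longlonglongrightarrow> K * 0 * hardy_norm g"
    unfolding P_def by (intro tendsto_intros hardy_norm_partial_tendsto f)
  then have "(\<lambda>N. K * hardy_norm (\<lambda>z. 1 * f z + (- 1) * P N z) * hardy_norm g) \<longlonglongrightarrow> 0"
    by (simp only: mult_zero_right mult_zero_left)
  from Lim_null_comparison[OF bound this]
  have "(\<lambda>N. hardy_inner (T (P N)) g - hardy_inner (T f) g) \<longlonglongrightarrow> 0" .
  then show ?thesis
    unfolding sums_def inner_P[symmetric] by (simp add: LIM_zero_iff)
qed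

text \<open>
  Both sides of the hypothesis are power series in \<open>cnj w\<close>, so comparing coefficients yields the
  adjoint identity on monomials; no representation theorem is needed.
\<close>

lemma hardy_adjoint_eqI:
  assumes T: "hardy_bounded_operator T" and g: "g \<in> hardy_space" and h: "h \<in> hardy_space"
    and kernel: "\<And>w. w \<in> unit_disk \<Longrightarrow> hardy_inner (T (hardy_kernel w)) g = cnj (h w)"
  shows "hardy_adjoint T g = h"
proof -
  have coeff: "hardy_inner (T (hardy_monomial n)) g = cnj (taylor_coeff h n)" for n
  proof -
    have T_sums: "(\<lambda>n. hardy_inner (T (hardy_monomial n)) g * z ^ n) sums cnj (h (cnj z))"
      if "z \<in> unit_disk" for z
      using bounded_operator_inner_sums[OF T hardy_kernel_in g, of "cnj z"] that
      by (simp add: kernel taylor_coeff_kernel mult.commute)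
    have h_sums: "(\<lambda>n. cnj (taylor_coeff h n) * z ^ n) sums cnj (h (cnj z))" if "z \<in> unit_disk" for z
    proof -
      have "(\<lambda>n. cnj (taylor_coeff h n * cnj z ^ n)) sums cnj (h (cnj z))"
        unfolding sums_cnj using that by (intro hardy_space_sums h) simp
      then show ?thesis by simp
    qed
    show ?thesis
      using taylor_coeff_eqI[OF T_sums, of n] taylor_coeff_eqI[OF h_sums, of n] by simp
  qed
  have adjoint: "hardy_inner (T f) g = hardy_inner f h" if "f \<in> hardy_space" for f
    using sums_unique2[OF bounded_operator_inner_sums[OF T that g]] hardy_inner_sums[OF that h]
    by (simp add: coeff)
  show ?thesis
    unfolding hardy_adjoint_def
  proof (rule the_equality)
    fix h' assume h': "h' \<in> hardy_space \<and> (\<forall>f\<in>hardy_space. hardy_inner (T f) g = hardy_inner f h')"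
    show "h' = h"
    proof (rule hardy_space_eqI)
      \<comment> \<open>Uniqueness of the representing vector: testing against the kernel at
        \<open>w\<close> recovers its value at \<open>w\<close>.\<close>
      fix w :: complex assume w: "w \<in> unit_disk"
      then have "hardy_inner (hardy_kernel w) h' = hardy_inner (hardy_kernel w) h"
        using h' adjoint hardy_kernel_in by metis
      then show "h' w = h w"
        using h' h w by (simp add: hardy_kernel_inner)
    qed (use h' h in auto)
  qed (use h adjoint in auto)
qed

section \<open>Complex symmetry and kernels\<close>

text \<open>
  The identity below says that the weighted composition operator maps \<open>1 / (1 - x z)\<close> to a
  multiple of a function of the same form and is its own transpose for the bilinear form \<open>\<langle>f, J g\<rangle>\<close>;
  it is cross-multiplied to avoid divisions.
\<close>

definition kernel_symmetric :: "(complex \<Rightarrow> complex) \<Rightarrow> (complex \<Rightarrow> complex) \<Rightarrow> bool" where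
  "kernel_symmetric \<psi> \<phi> \<longleftrightarrow>
     (\<forall>x\<in>unit_disk. \<forall>z\<in>unit_disk. \<psi> z * (1 - \<phi> x * z) = \<psi> x * (1 - \<phi> z * x))"

lemma kernel_symmetricD:
  assumes "kernel_symmetric \<psi> \<phi>" "x \<in> unit_disk" "z \<in> unit_disk" "\<phi> x \<in> unit_disk" "\<phi> z \<in> unit_disk"
  shows "\<psi> z / (1 - \<phi> z * x) = \<psi> x / (1 - \<phi> x * z)"
proof -
  have "\<psi> z * (1 - \<phi> x * z) = \<psi> x * (1 - \<phi> z * x)"
    using assms(1-3) unfolding kernel_symmetric_def by blast
  then show ?thesis
    unfolding frac_eq_eq[OF unit_disk_mult_neq[OF assms(5,2)] unit_disk_mult_neq[OF assms(4,3)]] .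
qed

text \<open>Inserting the formulas and cancelling \<open>1 - a0 * z\<close> leaves an expression in
  which \<open>x\<close> and \<open>z\<close> occur symmetrically.\<close>

lemma admissible_pair_kernel_symmetric:
  assumes "admissible_pair \<psi> \<phi>"
  shows "kernel_symmetric \<psi> \<phi>"
proof -
  obtain a0 a1 b where a0: "a0 \<in> unit_disk"
    and \<psi>: "\<And>z. z \<in> unit_disk \<Longrightarrow> \<psi> z = b / (1 - a0 * z)"
    and \<phi>: "\<And>z. z \<in> unit_disk \<Longrightarrow> \<phi> z = a0 + a1 * z / (1 - a0 * z)"
    using assms unfolding admissible_pair_def by blast
  have "\<psi> z * (1 - \<phi> x * z) = b - b * a1 * x * z / ((1 - a0 * x) * (1 - a0 * z))"
    if "x \<in> unit_disk" "z \<in> unit_disk" for x z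
    using unit_disk_mult_neq[OF a0 that(1)] unit_disk_mult_neq[OF a0 that(2)]
    unfolding \<psi>[OF that(2)] \<phi>[OF that(1)] by (simp add: divide_simps) (simp add: algebra_simps)
  then show ?thesis
    unfolding kernel_symmetric_def by (simp add: mult_ac)
qed

text \<open>Two values of \<open>x\<close> suffice: \<open>x = 0\<close> determines \<psi>, and
  \<open>x = 1 / 2\<close> then gives an equation that can be solved for
  \<open>\<phi> z\<close>.\<close>

lemma kernel_symmetric_admissible_pair:
  assumes sym: "kernel_symmetric \<psi> \<phi>" and \<phi>_disk: "\<And>z. z \<in> unit_disk \<Longrightarrow> \<phi> z \<in> unit_disk"
    and nonzero: "\<exists>z\<in>unit_disk. \<psi> z \<noteq> 0"
  shows "admissible_pair \<psi> \<phi>"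
proof -
  define a0 a1 b where "a0 = \<phi> 0" and "a1 = a0\<^sup>2 - 2 * a0 + (2 - a0) * \<phi> (1 / 2)" and "b = \<psi> 0"
  have a0: "a0 \<in> unit_disk" unfolding a0_def by (intro \<phi>_disk) simp
  have half: "(1 / 2 :: complex) \<in> unit_disk" by simp
  have nz: "1 - a0 * z \<noteq> 0" if "z \<in> unit_disk" for z using unit_disk_mult_neq[OF a0 that] .
  have \<psi>: "\<psi> z = b / (1 - a0 * z)" if "z \<in> unit_disk" for z
  proof -
    have "\<psi> z * (1 - \<phi> 0 * z) = \<psi> 0 * (1 - \<phi> z * 0)"
      using sym that unfolding kernel_symmetric_def by (metis centre_in_ball zero_less_one)
    then show ?thesis using nz[OF that] by (simp add: a0_def b_def field_simps)
  qed
  \<comment> \<open>This is where a nonzero weight enters: \<open>b\<close> has to be cancelled to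
    isolate \<phi>.\<close>
  have b: "b \<noteq> 0" using nonzero \<psi> by auto
  have \<phi>: "\<phi> z = a0 + a1 * z / (1 - a0 * z)" if z: "z \<in> unit_disk" for z
  proof -
    have "\<psi> z * (1 - \<phi> (1/2) * z) = \<psi> (1/2) * (1 - \<phi> z * (1/2))"
      using sym half z unfolding kernel_symmetric_def by blast
    then have "b * ((1 - a0 * (1/2)) * (1 - \<phi> (1/2) * z)) = b * ((1 - a0 * z) * (1 - \<phi> z * (1/2)))"
      using nz[OF z] nz[OF half] unfolding \<psi>[OF z] \<psi>[OF half] by (simp add: frac_eq_eq mult_ac)
    then have "(1 - a0 * (1/2)) * (1 - \<phi> (1/2) * z) = (1 - a0 * z) * (1 - \<phi> z * (1/2))"
      unfolding mult_left_cancel[OF b] .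
    then have "\<phi> z * (1 - a0 * z) = a0 * (1 - a0 * z) + a1 * z"
      unfolding a1_def by algebra
    then show ?thesis using nz[OF z] by (simp add: field_simps)
  qed
  have "(\<lambda>z. a0 + a1 * z / (1 - a0 * z)) holomorphic_on unit_disk"
    using nz by (intro holomorphic_intros) auto
  then have "\<phi> holomorphic_on unit_disk"
    by (rule holomorphic_transform) (simp add: \<phi>)
  then show ?thesis
    unfolding admissible_pair_def analytic_self_map_def using a0 \<psi> \<phi> \<phi>_disk by blast
qed

section \<open>Conjugations given by symbols\<close>

text \<open>The common setting of both conjugations. The two inverse laws are
  \<open>C (C f) = f\<close> read pointwise; the second also makes \<open>s\<close> a bijection of
  the disk with inverse taking \<open>y\<close> to \<open>cnj (s (cnj y))\<close>.\<close>

locale conjugation_symbol =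
  fixes u s :: "complex \<Rightarrow> complex"
  assumes s_disk: "z \<in> unit_disk \<Longrightarrow> s z \<in> unit_disk"
    and symmetric: "kernel_symmetric u s"
    and u_inverse: "z \<in> unit_disk \<Longrightarrow> u z * cnj (u (cnj (s z))) = 1"
    and s_inverse: "z \<in> unit_disk \<Longrightarrow> cnj (s (cnj (s z))) = z"
    and conjugation: "hardy_conjugation (weighted_comp u s \<circ> J_conj)"
begin

abbreviation C where "C \<equiv> weighted_comp u s \<circ> J_conj"

lemma C_apply: "z \<in> unit_disk \<Longrightarrow> C f z = u z * cnj (f (cnj (s z)))"
  by (simp add: weighted_comp_def J_conj_def)

lemma C_in: "f \<in> hardy_space \<Longrightarrow> C f \<in> hardy_space"
  and C_C: "f \<in> hardy_space \<Longrightarrow> C (C f) = f"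
  using conjugation unfolding hardy_conjugation_def by blast+

lemma u_nonzero: "z \<in> unit_disk \<Longrightarrow> u z \<noteq> 0"
  using u_inverse[of z] by auto

lemma cnj_s_disk: "z \<in> unit_disk \<Longrightarrow> cnj (s z) \<in> unit_disk"
  using s_disk[of z] by simp

text \<open>The adjoint of \<open>T\<close> is shown to be \<open>C T C\<close>, for which testing
  on kernels is enough; the claim then follows from \<open>C C = id\<close>.\<close>

lemma admissible_complex_symmetric:
  assumes T: "hardy_bounded_operator (weighted_comp \<psi>' \<phi>')"
    and adm: "admissible_pair \<psi> \<phi>"
    and \<psi>': "\<And>z. z \<in> unit_disk \<Longrightarrow> \<psi>' z = u z * \<psi> (s z)"
    and \<phi>': "\<And>z. z \<in> unit_disk \<Longrightarrow> \<phi>' z = \<phi> (s z)"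
  shows "complex_symmetric_with (weighted_comp \<psi>' \<phi>') C"
proof -
  define T where "T = weighted_comp \<psi>' \<phi>'"
  have T_apply: "T f z = u z * \<psi> (s z) * f (\<phi> (s z))" if "z \<in> unit_disk" for f z
    using that by (simp add: T_def weighted_comp_def \<psi>' \<phi>')
  have bounded: "hardy_bounded_operator T" using T by (simp add: T_def)
  then have T_in: "f \<in> hardy_space \<Longrightarrow> T f \<in> hardy_space" for f
    unfolding hardy_bounded_operator_def by blast
  have \<phi>_disk: "\<phi> z \<in> unit_disk" if "z \<in> unit_disk" for z
    using adm that unfolding admissible_pair_def analytic_self_map_def by blast
  note sym = admissible_pair_kernel_symmetric[OF adm]
  have adjoint: "hardy_adjoint T g = C (T (C g))" if g: "g \<in> hardy_space" for g
  proof (rule hardy_adjoint_eqI[OF bounded g])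
    show "C (T (C g)) \<in> hardy_space" by (intro C_in T_in g)
    fix w :: complex assume w: "w \<in> unit_disk"
    then have w': "cnj w \<in> unit_disk" by simp
    define x where "x = \<phi> (cnj w)"
    have x: "x \<in> unit_disk" unfolding x_def by (rule \<phi>_disk[OF w'])
    \<comment> \<open>Two exchanges: symmetry of \<open>(\<psi>, \<phi>)\<close> at
      \<open>cnj w\<close> and \<open>s z\<close> takes \<open>z\<close> out of \<phi>, and symmetry
      of \<open>(u, s)\<close> at \<open>x\<close> and \<open>z\<close> turns the rest into a
      multiple of a kernel.\<close>
    have T_kernel: "T (hardy_kernel w) = (\<lambda>z. \<psi> (cnj w) * u x * hardy_kernel (cnj (s x)) z)"
    proof
      fix z show "T (hardy_kernel w) z = \<psi> (cnj w) * u x * hardy_kernel (cnj (s x)) z"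
      proof (cases "z \<in> unit_disk")
        case True
        have "T (hardy_kernel w) z = u z * (\<psi> (s z) / (1 - \<phi> (s z) * cnj w))"
          using \<phi>_disk[OF s_disk[OF True]] by (simp add: T_apply[OF True] hardy_kernel_def mult.commute)
        also have "\<dots> = u z * (\<psi> (cnj w) / (1 - x * s z))"
          using kernel_symmetricD[OF sym w' s_disk[OF True] \<phi>_disk[OF w'] \<phi>_disk[OF s_disk[OF True]]]
          by (simp add: x_def)
        also have "\<dots> = \<psi> (cnj w) * (u z / (1 - s z * x))"
          by (simp add: mult.commute)
        also have "\<dots> = \<psi> (cnj w) * (u x / (1 - s x * z))"
          using kernel_symmetricD[OF symmetric x True s_disk[OF x] s_disk[OF True]] by simp
        finally show ?thesis using True by (simp add: hardy_kernel_def)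
      next
        case False
        then show ?thesis by (simp add: T_def weighted_comp_def hardy_kernel_def)
      qed
    qed
    have "hardy_inner (T (hardy_kernel w)) g = \<psi> (cnj w) * u x * cnj (g (cnj (s x)))"
      unfolding T_kernel
      unfolding hardy_inner_scale[OF hardy_kernel_in[OF cnj_s_disk[OF x]] g]
        hardy_kernel_inner[OF g cnj_s_disk[OF x]] ..
    moreover have "C (T (C g)) w = cnj (\<psi> (cnj w) * u x * cnj (g (cnj (s x))))"
    proof -
      \<comment> \<open>Since \<open>s y = cnj w\<close>, evaluating \<open>T (C g)\<close> at
        \<open>y\<close> produces \<psi> at \<open>cnj w\<close> and \<open>C g\<close> at
        \<open>x\<close>; the factors \<open>u w\<close> and \<open>cnj (u y)\<close>
        cancel.\<close>
      define y where "y = cnj (s w)"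
      have y: "y \<in> unit_disk" unfolding y_def by (rule cnj_s_disk[OF w])
      have "cnj (s y) = w" unfolding y_def by (rule s_inverse[OF w])
      then have sy: "s y = cnj w" by (metis complex_cnj_cnj)
      have "C (T (C g)) w = u w * cnj (T (C g) y)"
        unfolding C_apply[OF w] y_def ..
      also have "\<dots> = (u w * cnj (u y)) * cnj (\<psi> (cnj w) * C g x)"
        unfolding T_apply[OF y] sy x_def by simp
      also have "\<dots> = cnj (\<psi> (cnj w) * u x * cnj (g (cnj (s x))))"
        unfolding C_apply[OF x] using u_inverse[OF w] by (simp add: y_def)
      finally show ?thesis .
    qed
    ultimately show "hardy_inner (T (hardy_kernel w)) g = cnj (C (T (C g)) w)" by simp
  qed
  have "C (hardy_adjoint T (C f)) = T f" if "f \<in> hardy_space" for f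
    unfolding adjoint[OF C_in[OF that]] C_C[OF that] by (rule C_C[OF T_in[OF that]])
  then show ?thesis
    unfolding complex_symmetric_with_def using bounded conjugation unfolding T_def by blast
qed

text \<open>The adjoint sends kernels to multiples of kernels, so the symmetry condition becomes an
  explicit identity in two points. Removing \<open>s\<close> by its inverse leaves kernel symmetry
  of the pair sought.\<close>

lemma complex_symmetric_admissible:
  assumes self: "\<And>z. z \<in> unit_disk \<Longrightarrow> \<phi>' z \<in> unit_disk"
    and nonzero: "\<exists>z\<in>unit_disk. \<psi>' z \<noteq> 0"
    and symm: "complex_symmetric_with (weighted_comp \<psi>' \<phi>') C"
  shows "\<exists>\<psi> \<phi>. admissible_pair \<psi> \<phi> \<and>
    (\<forall>z\<in>unit_disk. \<psi>' z = u z * \<psi> (s z)) \<and> (\<forall>z\<in>unit_disk. \<phi>' z = \<phi> (s z))"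
proof -
  define T where "T = weighted_comp \<psi>' \<phi>'"
  have T_apply: "T f z = \<psi>' z * f (\<phi>' z)" if "z \<in> unit_disk" for f z
    using that by (simp add: T_def weighted_comp_def)
  have bounded: "hardy_bounded_operator T"
    and CT: "\<And>f. f \<in> hardy_space \<Longrightarrow> C (hardy_adjoint T (C f)) = T f"
    using symm unfolding complex_symmetric_with_def T_def by blast+
  have adjoint: "hardy_adjoint T (hardy_kernel v) = (\<lambda>z. cnj (\<psi>' v) * hardy_kernel (\<phi>' v) z)"
    if v: "v \<in> unit_disk" for v
  proof (rule hardy_adjoint_eqI[OF bounded hardy_kernel_in[OF v]])
    show "(\<lambda>z. cnj (\<psi>' v) * hardy_kernel (\<phi>' v) z) \<in> hardy_space"
      by (intro hardy_space_scale hardy_kernel_in self v)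
    fix w :: complex assume w: "w \<in> unit_disk"
    have "T (hardy_kernel w) \<in> hardy_space"
      using bounded hardy_kernel_in[OF w] unfolding hardy_bounded_operator_def by blast
    then show "hardy_inner (T (hardy_kernel w)) (hardy_kernel v) = cnj (cnj (\<psi>' v) * hardy_kernel (\<phi>' v) w)"
      unfolding hardy_inner_kernel[OF \<open>T (hardy_kernel w) \<in> hardy_space\<close> v] T_apply[OF v]
      using w self[OF v] by (simp add: hardy_kernel_def mult.commute)
  qed
  have key: "u z * (\<psi>' v * (1 - s v * \<phi>' z)) = u v * (\<psi>' z * (1 - \<phi>' v * s z))"
    if v: "v \<in> unit_disk" and z: "z \<in> unit_disk" for v z
  proof -
    note nz1 = unit_disk_mult_neq[OF self[OF v] s_disk[OF z]]
      and nz2 = unit_disk_mult_neq[OF s_disk[OF v] self[OF z]]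
    have "C (hardy_adjoint T (hardy_kernel v)) z = T (C (hardy_kernel v)) z"
      using CT[OF C_in[OF hardy_kernel_in[OF v]]] C_C[OF hardy_kernel_in[OF v]] by simp
    also have "C (hardy_adjoint T (hardy_kernel v)) z = u z * (\<psi>' v / (1 - \<phi>' v * s z))"
      unfolding adjoint[OF v] C_apply[OF z] using s_disk[OF z] by (simp add: hardy_kernel_def)
    also have "T (C (hardy_kernel v)) z = \<psi>' z * (u (\<phi>' z) / (1 - s (\<phi>' z) * v))"
      unfolding T_apply[OF z] C_apply[OF self[OF z]] using s_disk[OF self[OF z]]
      by (simp add: hardy_kernel_def mult.commute)
    \<comment> \<open>Symmetry of \<open>(u, s)\<close> frees \<open>u\<close> and \<open>s\<close>
      from the argument \<open>\<phi>' z\<close>, so that only \<phi>' itself remains in the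
      denominator.\<close>
    also have "\<dots> = \<psi>' z * (u v / (1 - s v * \<phi>' z))"
      using kernel_symmetricD[OF symmetric v self[OF z] s_disk[OF v] s_disk[OF self[OF z]]] by simp
    finally show ?thesis
      using nz1 nz2 by (simp add: frac_eq_eq mult_ac)
  qed
  \<comment> \<open>The inverse of \<open>s\<close> on the disk.\<close>
  define t where "t = (\<lambda>y. cnj (s (cnj y)))"
  have t_disk: "t y \<in> unit_disk" if "y \<in> unit_disk" for y
    using cnj_s_disk[of "cnj y"] that by (simp add: t_def)
  have s_t: "s (t y) = y" if "y \<in> unit_disk" for y
    using s_inverse[of "cnj y"] that by (simp add: t_def)
  have t_s: "t (s z) = z" if "z \<in> unit_disk" for z
    using s_inverse[OF that] by (simp add: t_def)
  \<comment> \<open>Obtained by solving \<open>\<psi>' z = u z * \<psi> (s z)\<close> and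
    \<open>\<phi>' z = \<phi> (s z)\<close> with \<open>z = t y\<close>.\<close>
  define \<psi> \<phi> where "\<psi> = (\<lambda>y. \<psi>' (t y) / u (t y))" and "\<phi> = (\<lambda>y. \<phi>' (t y))"
  have "kernel_symmetric \<psi> \<phi>"
    unfolding kernel_symmetric_def
  proof (intro ballI)
    fix x z :: complex assume x: "x \<in> unit_disk" and z: "z \<in> unit_disk"
    show "\<psi> z * (1 - \<phi> x * z) = \<psi> x * (1 - \<phi> z * x)"
      using key[OF t_disk[OF x] t_disk[OF z]] u_nonzero[OF t_disk[OF x]] u_nonzero[OF t_disk[OF z]]
      by (simp add: \<psi>_def \<phi>_def s_t[OF x] s_t[OF z] frac_eq_eq mult_ac)
  qed
  moreover have "\<phi> z \<in> unit_disk" if "z \<in> unit_disk" for z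
    unfolding \<phi>_def by (intro self t_disk that)
  moreover have \<psi>': "\<forall>z\<in>unit_disk. \<psi>' z = u z * \<psi> (s z)"
    using t_s u_nonzero by (simp add: \<psi>_def)
  moreover have "\<exists>z\<in>unit_disk. \<psi> z \<noteq> 0"
    using nonzero \<psi>' s_disk by (metis mult_zero_right)
  moreover have "\<forall>z\<in>unit_disk. \<phi>' z = \<phi> (s z)"
    using t_s by (simp add: \<phi>_def)
  ultimately show ?thesis
    using kernel_symmetric_admissible_pair by blast
qed

end

section \<open>The conjugations\<close>

text \<open>Multiplication by \<open>z\<close> shifts the coefficients up by one; the value 0 enters
  at index 0.\<close>

lemma taylor_coeff_affine_mult:
  assumes "g holomorphic_on unit_disk"
  shows "taylor_coeff (\<lambda>z. (a + b * z) * g z) n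
    = a * taylor_coeff g n + b * (case n of 0 \<Rightarrow> 0 | Suc m \<Rightarrow> taylor_coeff g m)"
proof (rule taylor_coeff_eqI)
  fix z :: complex assume "z \<in> unit_disk"
  then have g: "(\<lambda>n. taylor_coeff g n * z ^ n) sums g z"
    by (rule taylor_coeff_sums[OF assms])
  have "(\<lambda>n. (case Suc n of 0 \<Rightarrow> 0 | Suc m \<Rightarrow> taylor_coeff g m) * z ^ Suc n) sums (z * g z)"
    using sums_mult[OF g, of z] by (simp add: mult_ac)
  then have "(\<lambda>n. (case n of 0 \<Rightarrow> 0 | Suc m \<Rightarrow> taylor_coeff g m) * z ^ n) sums (z * g z)"
    by (subst (asm) sums_Suc_iff) simp
  from sums_add[OF sums_mult[OF g, of a] sums_mult[OF this, of b]]
  show "(\<lambda>n. (a * taylor_coeff g n + b * (case n of 0 \<Rightarrow> 0 | Suc m \<Rightarrow> taylor_coeff g m)) * z ^ n)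
      sums ((a + b * z) * g z)"
    by (simp add: algebra_simps)
qed

text \<open>
  Multiplication by the Blaschke factor \<open>(p - z) / (1 - cnj p * z)\<close> is isometric: the squared
  coefficients of numerator and denominator times \<open>g\<close> differ by a telescoping sequence.
\<close>

lemma Blaschke_factor_isometric:
  assumes g: "g holomorphic_on unit_disk" and lim: "taylor_coeff g \<longlonglongrightarrow> 0"
    and S: "(\<lambda>n. (cmod (taylor_coeff (\<lambda>z. (1 - cnj p * z) * g z) n))\<^sup>2) sums S"
  shows "(\<lambda>n. (cmod (taylor_coeff (\<lambda>z. (p - z) * g z) n))\<^sup>2) sums S"
proof -
  \<comment> \<open>\<open>b\<close> is the coefficient sequence of \<open>g\<close> shifted by one.
    As \<open>b 0 = 0\<close> and \<open>b\<close> tends to 0, the differences of \<open>B\<close>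
    sum to 0.\<close>
  define b where "b n = (case n of 0 \<Rightarrow> 0 | Suc m \<Rightarrow> taylor_coeff g m)" for n
  define B where "B n = (1 - (cmod p)\<^sup>2) * (cmod (b n))\<^sup>2" for n
  have b_Suc: "b (Suc n) = taylor_coeff g n" for n by (simp add: b_def)
  have "(\<lambda>n. b (Suc n)) \<longlonglongrightarrow> 0" using lim unfolding b_Suc .
  then have "b \<longlonglongrightarrow> 0" by (rule LIMSEQ_imp_Suc)
  then have "B \<longlonglongrightarrow> (1 - (cmod p)\<^sup>2) * (cmod 0)\<^sup>2"
    unfolding B_def by (intro tendsto_intros)
  from sums_add[OF S telescope_sums'[OF this]]
  have sums: "(\<lambda>n. (cmod (taylor_coeff (\<lambda>z. (1 - cnj p * z) * g z) n))\<^sup>2 + (B n - B (Suc n))) sums S"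
    by (simp add: B_def b_def)
  \<comment> \<open>Here \<open>x\<close> and \<open>y\<close> stand for coefficients
    \<open>n\<close> and \<open>n - 1\<close> of \<open>g\<close>; the real parts of the mixed terms
    agree on both sides.\<close>
  have "(cmod (1 * x + (- cnj p) * y))\<^sup>2 + ((1 - (cmod p)\<^sup>2) * (cmod y)\<^sup>2 - (1 - (cmod p)\<^sup>2) * (cmod x)\<^sup>2)
      = (cmod (p * x + (- 1) * y))\<^sup>2" for x y
    unfolding cmod_power2 by (simp add: power2_eq_square algebra_simps)
  then have "(cmod (taylor_coeff (\<lambda>z. (1 - cnj p * z) * g z) n))\<^sup>2 + (B n - B (Suc n))
      = (cmod (taylor_coeff (\<lambda>z. (p - z) * g z) n))\<^sup>2" for n
    using taylor_coeff_affine_mult[OF g, of 1 "- cnj p" n] taylor_coeff_affine_mult[OF g, of p "- 1" n]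
    unfolding B_def b_Suc b_def by simp
  then show ?thesis using sums by simp
qed

text \<open>The radius exceeds 1, so the Taylor series converges at the point 1 and its terms tend
  to 0.\<close>

lemma taylor_coeff_tendsto_0:
  assumes "g holomorphic_on ball 0 R" "1 < R"
  shows "taylor_coeff g \<longlonglongrightarrow> 0"
proof -
  have "(1::complex) \<in> ball 0 R" using assms(2) by simp
  from holomorphic_power_series[OF assms(1) this] have "summable (taylor_coeff g)"
    by (simp add: taylor_coeff_def[abs_def] sums_iff)
  then show ?thesis by (rule summable_LIMSEQ_zero)
qed

text \<open>Pythagoras for sequences: the cross term is twice the real part of a multiple of the
  vanishing inner product.\<close>

lemma orthogonal_add_sums:
  fixes x y :: "nat \<Rightarrow> complex"
  assumes "(\<lambda>n. (cmod (x n))\<^sup>2) sums X" "(\<lambda>n. (cmod (y n))\<^sup>2) sums Y" "(\<lambda>n. y n * cnj (x n)) sums 0"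
  shows "(\<lambda>n. (cmod (a * x n + y n))\<^sup>2) sums ((cmod a)\<^sup>2 * X + Y)"
proof -
  have "(\<lambda>n. Re (cnj a * (y n * cnj (x n)))) sums Re (cnj a * 0)"
    by (intro sums_Re sums_mult assms)
  then have "(\<lambda>n. (cmod a)\<^sup>2 * (cmod (x n))\<^sup>2 + (cmod (y n))\<^sup>2 + 2 * Re (cnj a * (y n * cnj (x n))))
      sums ((cmod a)\<^sup>2 * X + Y + 2 * Re (cnj a * 0))"
    by (intro sums_add sums_mult assms)
  moreover have "(cmod (a * x n + y n))\<^sup>2
      = (cmod a)\<^sup>2 * (cmod (x n))\<^sup>2 + (cmod (y n))\<^sup>2 + 2 * Re (cnj a * (y n * cnj (x n)))" for n
    unfolding cmod_power2 by (simp add: power2_eq_square algebra_simps)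
  ultimately show ?thesis by simp
qed

lemma hardy_space_conv_radius:
  assumes "f \<in> hardy_space"
  shows "1 \<le> conv_radius (taylor_coeff f)"
proof (rule conv_radius_geI_ex')
  fix r :: real assume "0 < r" "ereal r < 1"
  then have "complex_of_real r \<in> unit_disk" by simp
  from hardy_space_sums[OF assms this] show "summable (\<lambda>n. taylor_coeff f n * complex_of_real r ^ n)"
    by (rule sums_summable)
qed

text \<open>The Taylor polynomials of \<open>f\<close> composed with \<phi> converge uniformly near
  0, and uniform limits of holomorphic functions commute with derivatives.\<close>

lemma weighted_comp_taylor_coeff_tendsto:
  assumes f: "f \<in> hardy_space"
    and \<psi>: "\<psi> holomorphic_on unit_disk" and \<phi>: "\<phi> holomorphic_on unit_disk"
    and \<phi>_disk: "\<And>z. z \<in> unit_disk \<Longrightarrow> \<phi> z \<in> unit_disk"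
  shows "(\<lambda>N. taylor_coeff (\<lambda>z. \<psi> z * (\<Sum>n<N. taylor_coeff f n * \<phi> z ^ n)) m)
    \<longlonglongrightarrow> taylor_coeff (\<lambda>z. \<psi> z * f (\<phi> z)) m"
proof -
  define A where "A = cball (0::complex) (1 / 2)"
  have A: "compact A" "A \<subseteq> unit_disk" "A \<noteq> {}" by (auto simp: A_def)
  have cont: "continuous_on A \<psi>" "continuous_on A \<phi>" "continuous_on A (\<lambda>z. f (\<phi> z))"
  proof -
    have "\<phi> ` unit_disk \<subseteq> unit_disk" using \<phi>_disk by blast
    from holomorphic_on_compose_gen[OF \<phi> hardy_space_holomorphic[OF f] this]
    have comp: "(\<lambda>z. f (\<phi> z)) holomorphic_on unit_disk" by (simp add: o_def)
    show "continuous_on A \<psi>" "continuous_on A \<phi>" "continuous_on A (\<lambda>z. f (\<phi> z))"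
      by (intro continuous_on_subset[OF holomorphic_on_imp_continuous_on A(2)] \<psi> \<phi> comp)+
  qed
  \<comment> \<open>By compactness \<phi> keeps \<open>A\<close> away from the unit circle, so the
    Taylor series of \<open>f\<close> converges uniformly on the image.\<close>
  have "\<exists>\<rho><1. \<phi> ` A \<subseteq> cball 0 \<rho>"
  proof -
    have "continuous_on A (\<lambda>z. cmod (\<phi> z))" by (intro continuous_on_norm cont)
    then obtain z where z: "z \<in> A" "\<And>y. y \<in> A \<Longrightarrow> cmod (\<phi> y) \<le> cmod (\<phi> z)"
      using continuous_attains_sup[OF A(1) A(3)] by blast
    then have "cmod (\<phi> z) < 1" using \<phi>_disk[of z] A(2) by auto
    then show ?thesis using z by auto
  qed
  then obtain \<rho> where \<rho>: "\<rho> < 1" "\<phi> ` A \<subseteq> cball 0 \<rho>" by blast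
  have "ereal \<rho> < conv_radius (taylor_coeff f)"
    by (rule less_le_trans[OF _ hardy_space_conv_radius[OF f]]) (use \<rho>(1) in \<open>simp add: one_ereal_def\<close>)
  from powser_uniform_limit[OF this, of 0]
  have "uniform_limit (cball 0 \<rho>) (\<lambda>N z. \<Sum>n<N. taylor_coeff f n * z ^ n)
      (\<lambda>z. \<Sum>n. taylor_coeff f n * z ^ n) sequentially" by simp
  then have "uniform_limit A (\<lambda>N z. \<Sum>n<N. taylor_coeff f n * \<phi> z ^ n)
      (\<lambda>z. \<Sum>n. taylor_coeff f n * \<phi> z ^ n) sequentially"
    by (rule uniform_limit_compose') (use \<rho>(2) in auto)
  moreover have "(\<Sum>n. taylor_coeff f n * \<phi> z ^ n) = f (\<phi> z)" if "z \<in> A" for z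
    using hardy_space_sums[OF f \<phi>_disk[of z]] that A(2) by (auto simp: sums_iff)
  ultimately have "uniform_limit A (\<lambda>N z. \<Sum>n<N. taylor_coeff f n * \<phi> z ^ n) (\<lambda>z. f (\<phi> z)) sequentially"
    by (simp cong: uniform_limit_cong')
  then have "uniform_limit A (\<lambda>N z. \<psi> z * (\<Sum>n<N. taylor_coeff f n * \<phi> z ^ n)) (\<lambda>z. \<psi> z * f (\<phi> z)) sequentially"
    by (intro uniform_lim_mult uniform_limit_const compact_imp_bounded compact_continuous_image cont A(1))
  then have "uniform_limit (ball 0 (1/2)) (\<lambda>N z. \<psi> z * (\<Sum>n<N. taylor_coeff f n * \<phi> z ^ n)) (\<lambda>z. \<psi> z * f (\<phi> z)) sequentially"
    by (rule uniform_limit_on_subset) (auto simp: A_def)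
  moreover have "(\<lambda>z. \<psi> z * (\<Sum>n<N. taylor_coeff f n * \<phi> z ^ n)) holomorphic_on ball 0 (1/2)" for N
    by (intro holomorphic_intros holomorphic_on_subset[OF \<psi>] holomorphic_on_subset[OF \<phi>]) auto
  ultimately show ?thesis
    unfolding taylor_coeff_def
    by (intro tendsto_divide tendsto_const higher_deriv_complex_uniform_limit[where A = "ball 0 (1/2)"]) auto
qed

text \<open>A contraction on polynomials is one on the whole space because the coefficients converge.\<close>

lemma weighted_comp_contraction:
  assumes \<psi>: "\<psi> holomorphic_on unit_disk" and \<phi>: "\<phi> holomorphic_on unit_disk"
    and \<phi>_disk: "\<And>z. z \<in> unit_disk \<Longrightarrow> \<phi> z \<in> unit_disk"
    and polys: "\<And>a N. (\<lambda>m. (cmod (taylor_coeff (\<lambda>z. \<psi> z * (\<Sum>n<N. a n * \<phi> z ^ n)) m))\<^sup>2)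
      sums (\<Sum>n<N. (cmod (a n))\<^sup>2)"
    and f: "f \<in> hardy_space"
  shows "weighted_comp \<psi> \<phi> f \<in> hardy_space \<and> hardy_norm (weighted_comp \<psi> \<phi> f) \<le> hardy_norm f"
proof -
  define c where "c = taylor_coeff (\<lambda>z. \<psi> z * f (\<phi> z))"
  have holo: "(\<lambda>z. \<psi> z * f (\<phi> z)) holomorphic_on unit_disk"
  proof -
    have "\<phi> ` unit_disk \<subseteq> unit_disk" using \<phi>_disk by blast
    from holomorphic_on_mult[OF \<psi> holomorphic_on_compose_gen[OF \<phi> hardy_space_holomorphic[OF f] this]]
    show ?thesis by (simp add: o_def)
  qed
  have coeff: "taylor_coeff (weighted_comp \<psi> \<phi> f) = c"
    unfolding c_def by (intro ext taylor_coeff_cong[OF holo]) (simp add: weighted_comp_def)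
  \<comment> \<open>A Fatou argument: \<open>M\<close> is kept fixed while the truncation length
    \<open>N\<close> grows.\<close>
  have bound: "(\<Sum>m<M. (cmod (c m))\<^sup>2) \<le> (\<Sum>n. (cmod (taylor_coeff f n))\<^sup>2)" for M
  proof (rule LIMSEQ_le_const2)
    show "(\<lambda>N. \<Sum>m<M. (cmod (taylor_coeff (\<lambda>z. \<psi> z * (\<Sum>n<N. taylor_coeff f n * \<phi> z ^ n)) m))\<^sup>2)
        \<longlonglongrightarrow> (\<Sum>m<M. (cmod (c m))\<^sup>2)"
      unfolding c_def by (intro tendsto_intros weighted_comp_taylor_coeff_tendsto f \<psi> \<phi> \<phi>_disk)
    have "(\<Sum>m<M. (cmod (taylor_coeff (\<lambda>z. \<psi> z * (\<Sum>n<N. taylor_coeff f n * \<phi> z ^ n)) m))\<^sup>2)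
        \<le> (\<Sum>n. (cmod (taylor_coeff f n))\<^sup>2)" for N
    proof -
      note sums = polys[where a = "taylor_coeff f" and N = N]
      have "(\<Sum>m<M. (cmod (taylor_coeff (\<lambda>z. \<psi> z * (\<Sum>n<N. taylor_coeff f n * \<phi> z ^ n)) m))\<^sup>2)
          \<le> (\<Sum>n<N. (cmod (taylor_coeff f n))\<^sup>2)"
        unfolding sums_unique[OF sums] by (intro sum_le_suminf sums_summable[OF sums]) auto
      also have "\<dots> \<le> (\<Sum>n. (cmod (taylor_coeff f n))\<^sup>2)"
        by (intro sum_le_suminf hardy_space_summable f) auto
      finally show ?thesis .
    qed
    then show "\<exists>N0. \<forall>N\<ge>N0. (\<Sum>m<M. (cmod (taylor_coeff (\<lambda>z. \<psi> z * (\<Sum>n<N. taylor_coeff f n * \<phi> z ^ n)) m))\<^sup>2)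
        \<le> (\<Sum>n. (cmod (taylor_coeff f n))\<^sup>2)" by blast
  qed
  have summable: "summable (\<lambda>m. (cmod (c m))\<^sup>2)"
    by (rule summableI_nonneg_bounded[OF _ bound]) simp
  then have "weighted_comp \<psi> \<phi> f \<in> hardy_space"
    unfolding hardy_space_def mem_Collect_eq coeff
    using holomorphic_transform[OF holo, of "weighted_comp \<psi> \<phi> f"] by (auto simp: weighted_comp_def)
  moreover have "hardy_norm (weighted_comp \<psi> \<phi> f) \<le> hardy_norm f"
    unfolding hardy_norm_def coeff by (intro real_sqrt_le_mono suminf_le_const summable bound)
  ultimately show ?thesis ..
qed

text \<open>\<open>J_conj\<close> conjugates each Taylor coefficient, which changes no
  modulus.\<close>

lemma
  assumes f: "f \<in> hardy_space"
  shows J_conj_in: "J_conj f \<in> hardy_space"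
    and hardy_norm_J_conj: "hardy_norm (J_conj f) = hardy_norm f"
proof -
  have sums: "(\<lambda>n. cnj (taylor_coeff f n) * z ^ n) sums J_conj f z" if "z \<in> unit_disk" for z
  proof -
    have "(\<lambda>n. cnj (taylor_coeff f n * cnj z ^ n)) sums cnj (f (cnj z))"
      unfolding sums_cnj using that by (intro hardy_space_sums f) simp
    then show ?thesis by (simp add: J_conj_def)
  qed
  show "J_conj f \<in> hardy_space"
    by (rule hardy_spaceI[OF sums])
      (use hardy_space_summable[OF f] hardy_space_outside[OF f] in \<open>auto simp: J_conj_def\<close>)
  show "hardy_norm (J_conj f) = hardy_norm f"
    unfolding hardy_norm_def using taylor_coeff_eqI[OF sums] by simp
qed

text \<open>A contraction that is its own inverse preserves norms: apply the inequality to
  \<open>f\<close> and to \<open>C f\<close>.\<close>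

lemma hardy_conjugationI:
  assumes s_disk: "\<And>z. z \<in> unit_disk \<Longrightarrow> s z \<in> unit_disk"
    and u_inverse: "\<And>z. z \<in> unit_disk \<Longrightarrow> u z * cnj (u (cnj (s z))) = 1"
    and s_inverse: "\<And>z. z \<in> unit_disk \<Longrightarrow> cnj (s (cnj (s z))) = z"
    and contraction: "\<And>f. f \<in> hardy_space \<Longrightarrow>
      weighted_comp u s f \<in> hardy_space \<and> hardy_norm (weighted_comp u s f) \<le> hardy_norm f"
  shows "hardy_conjugation (weighted_comp u s \<circ> J_conj)"
proof -
  define C where "C = weighted_comp u s \<circ> J_conj"
  have C_in: "C f \<in> hardy_space" and C_le: "hardy_norm (C f) \<le> hardy_norm f"
    if "f \<in> hardy_space" for f
    using contraction[OF J_conj_in[OF that]] hardy_norm_J_conj[OF that] by (auto simp: C_def)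
  have C_apply: "C f z = u z * cnj (f (cnj (s z)))" if "z \<in> unit_disk" for f z
    using that by (simp add: C_def weighted_comp_def J_conj_def)
  have C_C: "C (C f) = f" if f: "f \<in> hardy_space" for f
  proof (rule hardy_space_eqI)
    fix z :: complex assume z: "z \<in> unit_disk"
    then have y: "cnj (s z) \<in> unit_disk" using s_disk[OF z] by simp
    have "C (C f) z = (u z * cnj (u (cnj (s z)))) * f z"
      unfolding C_apply[OF z] C_apply[OF y] s_inverse[OF z] by simp
    then show "C (C f) z = f z" unfolding u_inverse[OF z] by simp
  qed (intro C_in f, rule f)
  have "hardy_norm (C f) = hardy_norm f" if "f \<in> hardy_space" for f
    using C_le[OF that] C_le[OF C_in[OF that]] by (simp add: C_C that)
  moreover have "C (\<lambda>z. f z + g z) = (\<lambda>z. C f z + C g z)" "C (\<lambda>z. a * f z) = (\<lambda>z. cnj a * C f z)" for a f g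
    by (auto simp: C_def weighted_comp_def J_conj_def algebra_simps)
  ultimately show ?thesis
    unfolding hardy_conjugation_def C_def[symmetric] using C_in C_C by blast
qed

text \<open>Rotation multiplies the coefficient of index \<open>n\<close> by \<open>l ^ n\<close>, a
  number of modulus 1.\<close>

lemma conjugation_symbol_rotation:
  assumes l: "cmod l = 1"
  shows "conjugation_symbol (\<lambda>_. 1) (\<lambda>z. l * z)"
proof
  have disk: "l * z \<in> unit_disk" if "z \<in> unit_disk" for z
    using that l by (simp add: norm_mult)
  have inverse: "cnj (l * cnj (l * z)) = z" for z
    using complex_norm_square[of l] l by (simp add: mult_ac)
  show "kernel_symmetric (\<lambda>_. 1) (\<lambda>z. l * z)"
    unfolding kernel_symmetric_def by (simp add: mult_ac)
  show "hardy_conjugation (weighted_comp (\<lambda>_. 1) (\<lambda>z. l * z) \<circ> J_conj)"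
  proof (rule hardy_conjugationI)
    fix f :: "complex \<Rightarrow> complex" assume f: "f \<in> hardy_space"
    have sums: "(\<lambda>n. (taylor_coeff f n * l ^ n) * z ^ n) sums weighted_comp (\<lambda>_. 1) (\<lambda>z. l * z) f z"
      if "z \<in> unit_disk" for z
      using hardy_space_sums[OF f disk[OF that]] that by (simp add: weighted_comp_def power_mult_distrib mult_ac)
    have norm: "cmod (taylor_coeff f n * l ^ n) = cmod (taylor_coeff f n)" for n
      using l by (simp add: norm_mult norm_power)
    have "weighted_comp (\<lambda>_. 1) (\<lambda>z. l * z) f \<in> hardy_space"
      by (rule hardy_spaceI[OF sums])
        (use hardy_space_summable[OF f] in \<open>auto simp: norm weighted_comp_def\<close>)
    moreover have "hardy_norm (weighted_comp (\<lambda>_. 1) (\<lambda>z. l * z) f) = hardy_norm f"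
      unfolding hardy_norm_def using taylor_coeff_eqI[OF sums] norm by simp
    ultimately show "weighted_comp (\<lambda>_. 1) (\<lambda>z. l * z) f \<in> hardy_space \<and>
        hardy_norm (weighted_comp (\<lambda>_. 1) (\<lambda>z. l * z) f) \<le> hardy_norm f" by simp
  qed (use disk inverse in auto)
qed (use l complex_norm_square[of l] in \<open>auto simp: norm_mult mult_ac\<close>)

section \<open>The symbols \<open>psi_p\<close> and \<open>phi_p\<close>\<close>

context
  fixes p c :: complex
  assumes p: "p \<in> unit_disk" "p \<noteq> 0" and c: "cmod c = 1"
begin

lemma denom_nonzero: "z \<in> unit_disk \<Longrightarrow> 1 - cnj p * z \<noteq> 0"
  using p(1) by (intro unit_disk_mult_neq) auto

lemma denom_nonzero_large:
  assumes "z \<in> ball 0 (1 / cmod p)"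
  shows "1 - cnj p * z \<noteq> 0"
proof -
  have "cmod (cnj p * z) < 1" using assms p(2) by (simp add: norm_mult field_simps)
  then show ?thesis by auto
qed

lemma large_radius: "1 < 1 / cmod p"
  using p by simp

lemma sqrt_square: "(complex_of_real (sqrt (1 - (cmod p)\<^sup>2)))\<^sup>2 = 1 - p * cnj p"
proof -
  have "(cmod p)\<^sup>2 \<le> 1" using p(1) by (simp add: power_le_one)
  then have "(complex_of_real (sqrt (1 - (cmod p)\<^sup>2)))\<^sup>2 = complex_of_real (1 - (cmod p)\<^sup>2)"
    by (simp only: of_real_power[symmetric]) simp
  then show ?thesis unfolding of_real_diff complex_norm_square by simp
qed

text \<open>Up to a factor of modulus 1 this is the Moebius function of the disk that vanishes at
  \<open>p\<close>.\<close>

lemma phi_p_disk: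
  assumes "z \<in> unit_disk"
  shows "phi_p p z \<in> unit_disk"
proof -
  have "cmod (phi_p p z) = cmod (Moebius_function 0 p z)"
    using p(2) by (simp add: phi_p_def Moebius_function_simple norm_mult norm_divide norm_minus_commute)
  also have "\<dots> < 1"
    using assms p(1) by (intro Moebius_function_norm_lt_1) auto
  finally show ?thesis by simp
qed

text \<open>The only pole is \<open>1 / cnj p\<close>. The larger disk matters because
  \<open>taylor_coeff_tendsto_0\<close> needs a radius above 1.\<close>

lemma phi_p_holomorphic: "phi_p p holomorphic_on ball 0 (1 / cmod p)"
  unfolding phi_p_def[abs_def] using denom_nonzero_large by (intro holomorphic_intros) auto

lemma psi_p_holomorphic: "psi_p c p holomorphic_on ball 0 (1 / cmod p)"
  unfolding psi_p_def[abs_def] using denom_nonzero_large by (intro holomorphic_intros) auto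

lemma unit_disk_subset_large: "unit_disk \<subseteq> ball 0 (1 / cmod p)"
  using large_radius by (intro subset_ball) simp

text \<open>The factor \<open>cnj p / p\<close> in \<open>phi_p\<close> is what gives
  \<open>x\<close> and \<open>z\<close> the same coefficient \<open>- cnj p\<close> in the
  numerator.\<close>

lemma kernel_symmetric_psi_p: "kernel_symmetric (psi_p c p) (phi_p p)"
proof -
  have "psi_p c p z * (1 - phi_p p x * z) =
      c * of_real (sqrt (1 - (cmod p)\<^sup>2)) * (1 - cnj p * x - cnj p * z + cnj p / p * x * z)
        / ((1 - cnj p * x) * (1 - cnj p * z))"
    if "x \<in> unit_disk" "z \<in> unit_disk" for x z
    using denom_nonzero[OF that(1)] denom_nonzero[OF that(2)] p(2)
    by (simp add: psi_p_def phi_p_def divide_simps) (simp add: algebra_simps)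
  then show ?thesis
    unfolding kernel_symmetric_def by (simp add: mult_ac add_ac diff_diff_eq)
qed

text \<open>The left side is the conjugated denominator of \<open>psi_p\<close> and
  \<open>phi_p\<close> at \<open>cnj (phi_p p z)\<close>, as needed for both inverse laws.\<close>

lemma denom_cnj_phi_p:
  assumes "z \<in> unit_disk"
  shows "1 - p * phi_p p z = (1 - p * cnj p) / (1 - cnj p * z)"
proof -
  have "p * phi_p p z = cnj p * (p - z) / (1 - cnj p * z)"
    using p(2) by (simp add: phi_p_def)
  then have "1 - p * phi_p p z = ((1 - cnj p * z) - cnj p * (p - z)) / (1 - cnj p * z)"
    using denom_nonzero[OF assms] by (simp add: diff_divide_distrib)
  also have "(1 - cnj p * z) - cnj p * (p - z) = 1 - p * cnj p"
    by (simp add: algebra_simps)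
  finally show ?thesis .
qed

lemma phi_p_inverse:
  assumes z: "z \<in> unit_disk"
  shows "cnj (phi_p p (cnj (phi_p p z))) = z"
proof -
  have pp: "1 - p * cnj p \<noteq> 0" using denom_nonzero[OF p(1)] by (simp add: mult.commute)
  have "cnj p - phi_p p z = cnj p / p * z * (1 - p * cnj p) / (1 - cnj p * z)"
    using denom_nonzero[OF z] p(2) by (simp add: phi_p_def divide_simps) (simp add: algebra_simps)
  then have "(cnj p - phi_p p z) / (1 - p * phi_p p z) = cnj p / p * z"
    unfolding denom_cnj_phi_p[OF z] using denom_nonzero[OF z] pp by simp
  moreover have "cnj (phi_p p (cnj (phi_p p z))) = p / cnj p * ((cnj p - phi_p p z) / (1 - p * phi_p p z))"
    unfolding phi_p_def[of p "cnj (phi_p p z)"] by simp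
  ultimately show ?thesis using p(2) by simp
qed

text \<open>The denominators cancel, and the square-root normalisation together with
  \<open>cmod c = 1\<close> makes the remaining constant 1.\<close>

lemma psi_p_inverse:
  assumes z: "z \<in> unit_disk"
  shows "psi_p c p z * cnj (psi_p c p (cnj (phi_p p z))) = 1"
proof -
  have pp: "1 - p * cnj p \<noteq> 0" using denom_nonzero[OF p(1)] by (simp add: mult.commute)
  define r where "r = complex_of_real (sqrt (1 - (cmod p)\<^sup>2))"
  have cc: "c * cnj c = 1" using complex_norm_square[of c] c by simp
  have "cnj (psi_p c p (cnj (phi_p p z))) = cnj c * (r / (1 - p * phi_p p z))"
    by (simp add: psi_p_def r_def)
  also have "\<dots> = cnj c * r * (1 - cnj p * z) / (1 - p * cnj p)"
    unfolding denom_cnj_phi_p[OF z] by simp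
  finally have "psi_p c p z * cnj (psi_p c p (cnj (phi_p p z)))
      = (c * (r / (1 - cnj p * z))) * (cnj c * r * (1 - cnj p * z) / (1 - p * cnj p))"
    by (simp add: psi_p_def r_def)
  also have "\<dots> = (c * cnj c) * (r\<^sup>2 / (1 - p * cnj p))"
    using denom_nonzero[OF z] by (simp add: power2_eq_square)
  also have "\<dots> = 1" using cc sqrt_square pp by (simp add: r_def)
  finally show ?thesis .
qed

lemma psi_p_taylor_coeff: "taylor_coeff (psi_p c p) n = c * of_real (sqrt (1 - (cmod p)\<^sup>2)) * cnj p ^ n"
proof (rule taylor_coeff_eqI)
  fix z :: complex assume z: "z \<in> unit_disk"
  then have "(\<lambda>n. cnj p ^ n * z ^ n) sums (1 / (1 - cnj p * z))"
    using hardy_kernel_sums[OF p(1) z] by (simp add: hardy_kernel_def)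
  from sums_mult[OF this, of "c * of_real (sqrt (1 - (cmod p)\<^sup>2))"]
  show "(\<lambda>n. c * of_real (sqrt (1 - (cmod p)\<^sup>2)) * cnj p ^ n * z ^ n) sums psi_p c p z"
    by (simp add: psi_p_def mult_ac)
qed

text \<open>\<open>psi_p\<close> is \<open>c\<close> times the normalised kernel at
  \<open>p\<close>; its squared coefficients form a geometric series.\<close>

lemma psi_p_norm_sums: "(\<lambda>n. (cmod (taylor_coeff (psi_p c p) n))\<^sup>2) sums 1"
proof -
  have less: "(cmod p)\<^sup>2 < 1" using p(1) by (simp add: power_less_one_iff)
  then have "(\<lambda>n. (1 - (cmod p)\<^sup>2) * ((cmod p)\<^sup>2) ^ n) sums ((1 - (cmod p)\<^sup>2) * (1 / (1 - (cmod p)\<^sup>2)))"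
    by (intro sums_mult geometric_sums) simp
  moreover have "(cmod (taylor_coeff (psi_p c p) n))\<^sup>2 = (1 - (cmod p)\<^sup>2) * ((cmod p)\<^sup>2) ^ n" for n
    using less c by (simp add: psi_p_taylor_coeff norm_mult norm_power power_mult_distrib
        power_mult[symmetric] mult.commute)
  ultimately show ?thesis using less by simp
qed

text \<open>
  Write the polynomial as \<open>a0 + z q\<close>. Its image is \<open>a0 \<psi>\<^sub>p + \<phi>\<^sub>p W\<close> with \<open>W\<close> the image of \<open>q\<close>; the
  summands are orthogonal because \<open>\<psi>\<^sub>p\<close> is a multiple of the kernel at \<open>p\<close>, where \<open>\<phi>\<^sub>p\<close> vanishes.
\<close>

lemma psi_p_polynomial_sums:
  "(\<lambda>m. (cmod (taylor_coeff (\<lambda>z. psi_p c p z * (\<Sum>n<N. a n * phi_p p z ^ n)) m))\<^sup>2)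
     sums (\<Sum>n<N. (cmod (a n))\<^sup>2)"
proof (induction N arbitrary: a)
  case 0
  have "taylor_coeff (\<lambda>z. 0) m = 0" for m by (rule taylor_coeff_eqI) simp
  then show ?case by simp
next
  case (Suc N)
  define W where "W z = psi_p c p z * (\<Sum>n<N. a (Suc n) * phi_p p z ^ n)" for z
  \<comment> \<open>Dividing out the denominator gives \<open>W = (1 - cnj p * z) * g\<close> and
    \<open>phi_p * W = cnj p / p * ((p - z) * g)\<close>, the two products compared by
    \<open>Blaschke_factor_isometric\<close>.\<close>
  define g where "g z = W z / (1 - cnj p * z)" for z
  have W: "W holomorphic_on ball 0 (1 / cmod p)"
    unfolding W_def[abs_def] by (intro holomorphic_intros psi_p_holomorphic phi_p_holomorphic)
  have g: "g holomorphic_on ball 0 (1 / cmod p)"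
    unfolding g_def[abs_def] using denom_nonzero_large by (intro holomorphic_intros W) auto
  note on_disk = holomorphic_on_subset[OF _ unit_disk_subset_large]
  have W_disk: "W holomorphic_on unit_disk" and g_disk: "g holomorphic_on unit_disk"
    and psi_disk: "psi_p c p holomorphic_on unit_disk" and phi_disk: "phi_p p holomorphic_on unit_disk"
    by (intro on_disk W g psi_p_holomorphic phi_p_holomorphic)+
  have phi_W: "(\<lambda>z. phi_p p z * W z) holomorphic_on unit_disk"
    by (intro holomorphic_on_mult phi_disk W_disk)
  have "taylor_coeff (\<lambda>z. (1 - cnj p * z) * g z) m = taylor_coeff W m" for m
    by (rule taylor_coeff_cong[OF W_disk]) (use denom_nonzero in \<open>auto simp: g_def\<close>)
  then have "(\<lambda>m. (cmod (taylor_coeff (\<lambda>z. (1 - cnj p * z) * g z) m))\<^sup>2) sums (\<Sum>n<N. (cmod (a (Suc n)))\<^sup>2)"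
    using Suc.IH[of "\<lambda>n. a (Suc n)"] by (simp add: W_def[abs_def])
  then have "(\<lambda>m. (cmod (taylor_coeff (\<lambda>z. (p - z) * g z) m))\<^sup>2) sums (\<Sum>n<N. (cmod (a (Suc n)))\<^sup>2)"
    by (rule Blaschke_factor_isometric[OF g_disk taylor_coeff_tendsto_0[OF g large_radius]])
  moreover have "taylor_coeff (\<lambda>z. phi_p p z * W z) m = cnj p / p * taylor_coeff (\<lambda>z. (p - z) * g z) m" for m
  proof -
    have holo: "(\<lambda>z. (p - z) * g z) holomorphic_on unit_disk" by (intro holomorphic_intros g_disk)
    \<comment> \<open>The zero summand brings the scalar multiple into the form of
      \<open>taylor_coeff_linear\<close>.\<close>
    have "(\<lambda>z. (cnj p / p) * ((p - z) * g z) + 0 * ((p - z) * g z)) holomorphic_on unit_disk"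
      by (intro holomorphic_intros g_disk)
    then have "taylor_coeff (\<lambda>z. phi_p p z * W z) m
        = taylor_coeff (\<lambda>z. (cnj p / p) * ((p - z) * g z) + 0 * ((p - z) * g z)) m"
      by (rule taylor_coeff_cong) (simp add: phi_p_def g_def)
    then show ?thesis using taylor_coeff_linear[OF holo holo, of "cnj p / p" 0 m] by simp
  qed
  ultimately have phi_W_sums:
    "(\<lambda>m. (cmod (taylor_coeff (\<lambda>z. phi_p p z * W z) m))\<^sup>2) sums (\<Sum>n<N. (cmod (a (Suc n)))\<^sup>2)"
    using p(2) by (simp add: norm_mult norm_divide)
  have "(\<lambda>m. taylor_coeff (\<lambda>z. phi_p p z * W z) m * p ^ m) sums 0"
    using taylor_coeff_sums[OF phi_W p(1)] by (simp add: phi_p_def)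
  from sums_mult[OF this, of "cnj (c * of_real (sqrt (1 - (cmod p)\<^sup>2)))"]
  have orth: "(\<lambda>m. taylor_coeff (\<lambda>z. phi_p p z * W z) m * cnj (taylor_coeff (psi_p c p) m)) sums 0"
    by (simp add: psi_p_taylor_coeff mult_ac)
  have "psi_p c p z * (\<Sum>n<Suc N. a n * phi_p p z ^ n) = a 0 * psi_p c p z + 1 * (phi_p p z * W z)" for z
    unfolding sum.lessThan_Suc_shift W_def by (simp add: algebra_simps sum_distrib_left)
  then have "taylor_coeff (\<lambda>z. psi_p c p z * (\<Sum>n<Suc N. a n * phi_p p z ^ n)) m
      = a 0 * taylor_coeff (psi_p c p) m + taylor_coeff (\<lambda>z. phi_p p z * W z) m" for m
    using taylor_coeff_linear[OF psi_disk phi_W, of "a 0" 1 m] by simp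
  then show ?case
    using orthogonal_add_sums[OF psi_p_norm_sums phi_W_sums orth, of "a 0"]
    unfolding sum.lessThan_Suc_shift by simp
qed

lemma conjugation_symbol_psi_p: "conjugation_symbol (psi_p c p) (phi_p p)"
proof
  show "hardy_conjugation (weighted_comp (psi_p c p) (phi_p p) \<circ> J_conj)"
    by (intro hardy_conjugationI weighted_comp_contraction phi_p_disk psi_p_inverse phi_p_inverse
        psi_p_polynomial_sums holomorphic_on_subset[OF psi_p_holomorphic unit_disk_subset_large]
        holomorphic_on_subset[OF phi_p_holomorphic unit_disk_subset_large])
qed (intro phi_p_disk psi_p_inverse phi_p_inverse kernel_symmetric_psi_p | assumption)+

end

text \<open>The converse directions assume a weight that is not identically zero on the disk: the
  zero operator is complex symmetric with every conjugation, whatever \<open>phi_t\<close> is, so it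
  says nothing about the form of \<open>phi_t\<close>.\<close>

theorem theorem2p5:
  fixes psi_t phi_t :: "complex \<Rightarrow> complex"
  assumes "psi_t holomorphic_on unit_disk"
    and "analytic_self_map phi_t"
    and "hardy_bounded_operator (weighted_comp psi_t phi_t)"
  shows
    "(\<forall>p c. p \<in> unit_disk - {0} \<and> cmod c = 1 \<longrightarrow>
        ((\<exists>\<psi> \<phi>. admissible_pair \<psi> \<phi> \<and>
            (\<forall>z\<in>unit_disk. psi_t z = psi_p c p z * \<psi> (phi_p p z)) \<and>
            (\<forall>z\<in>unit_disk. phi_t z = \<phi> (phi_p p z))) \<longrightarrow>
          complex_symmetric_with (weighted_comp psi_t phi_t)
            (weighted_comp (psi_p c p) (phi_p p) \<circ> J_conj)) \<and>
        ((\<exists>z\<in>unit_disk. psi_t z \<noteq> 0) \<longrightarrow>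
          complex_symmetric_with (weighted_comp psi_t phi_t)
            (weighted_comp (psi_p c p) (phi_p p) \<circ> J_conj) \<longrightarrow>
          (\<exists>\<psi> \<phi>. admissible_pair \<psi> \<phi> \<and>
            (\<forall>z\<in>unit_disk. psi_t z = psi_p c p z * \<psi> (phi_p p z)) \<and>
            (\<forall>z\<in>unit_disk. phi_t z = \<phi> (phi_p p z))))) \<and>
     (\<forall>l. cmod l = 1 \<longrightarrow>
        ((\<exists>\<psi> \<phi>. admissible_pair \<psi> \<phi> \<and>
            (\<forall>z\<in>unit_disk. psi_t z = \<psi> (l * z)) \<and>
            (\<forall>z\<in>unit_disk. phi_t z = \<phi> (l * z))) \<longrightarrow>
          complex_symmetric_with (weighted_comp psi_t phi_t)
            (comp_op (\<lambda>z. l * z) \<circ> J_conj)) \<and>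
        ((\<exists>z\<in>unit_disk. psi_t z \<noteq> 0) \<longrightarrow>
          complex_symmetric_with (weighted_comp psi_t phi_t)
            (comp_op (\<lambda>z. l * z) \<circ> J_conj) \<longrightarrow>
          (\<exists>\<psi> \<phi>. admissible_pair \<psi> \<phi> \<and>
            (\<forall>z\<in>unit_disk. psi_t z = \<psi> (l * z)) \<and>
            (\<forall>z\<in>unit_disk. phi_t z = \<phi> (l * z)))))"
proof -
  have self: "\<And>z. z \<in> unit_disk \<Longrightarrow> phi_t z \<in> unit_disk"
    using assms(2) unfolding analytic_self_map_def by blast
  show ?thesis
  proof (intro conjI allI impI)
    fix p c :: complex assume pc: "p \<in> unit_disk - {0} \<and> cmod c = 1"
    interpret conjugation_symbol "psi_p c p" "phi_p p"
      using pc by (intro conjugation_symbol_psi_p) auto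
    show "complex_symmetric_with (weighted_comp psi_t phi_t) (weighted_comp (psi_p c p) (phi_p p) \<circ> J_conj)"
      if "\<exists>\<psi> \<phi>. admissible_pair \<psi> \<phi> \<and>
            (\<forall>z\<in>unit_disk. psi_t z = psi_p c p z * \<psi> (phi_p p z)) \<and>
            (\<forall>z\<in>unit_disk. phi_t z = \<phi> (phi_p p z))"
      using that admissible_complex_symmetric[OF assms(3)] by blast
    show "\<exists>\<psi> \<phi>. admissible_pair \<psi> \<phi> \<and>
            (\<forall>z\<in>unit_disk. psi_t z = psi_p c p z * \<psi> (phi_p p z)) \<and>
            (\<forall>z\<in>unit_disk. phi_t z = \<phi> (phi_p p z))"
      if "\<exists>z\<in>unit_disk. psi_t z \<noteq> 0"
        "complex_symmetric_with (weighted_comp psi_t phi_t) (weighted_comp (psi_p c p) (phi_p p) \<circ> J_conj)"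
      using complex_symmetric_admissible[OF self that] .
  next
    fix l :: complex assume l: "cmod l = 1"
    \<comment> \<open>\<open>comp_op\<close> is the weighted operator of weight 1, so the locale
      results apply after unfolding it and removing the factor 1.\<close>
    interpret conjugation_symbol "\<lambda>_. 1" "\<lambda>z. l * z"
      by (rule conjugation_symbol_rotation[OF l])
    show "complex_symmetric_with (weighted_comp psi_t phi_t) (comp_op (\<lambda>z. l * z) \<circ> J_conj)"
      if "\<exists>\<psi> \<phi>. admissible_pair \<psi> \<phi> \<and>
            (\<forall>z\<in>unit_disk. psi_t z = \<psi> (l * z)) \<and>
            (\<forall>z\<in>unit_disk. phi_t z = \<phi> (l * z))"
      using that admissible_complex_symmetric[OF assms(3)] unfolding comp_op_def mult_1 by blast
    show "\<exists>\<psi> \<phi>. admissible_pair \<psi> \<phi> \<and>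
            (\<forall>z\<in>unit_disk. psi_t z = \<psi> (l * z)) \<and>
            (\<forall>z\<in>unit_disk. phi_t z = \<phi> (l * z))"
      if "\<exists>z\<in>unit_disk. psi_t z \<noteq> 0"
        "complex_symmetric_with (weighted_comp psi_t phi_t) (comp_op (\<lambda>z. l * z) \<circ> J_conj)"
      using complex_symmetric_admissible[OF self that(1) that(2)[unfolded comp_op_def]] unfolding mult_1 .
  qed
qed

end
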